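(* Let $p$ be a prime and $k\geq2$ an integer. Let $a_1,\dots,a_k$ be pairwise distinct $p$-adic integers with $a_i\equiv1\pmod p$ for all $i$; if $p=2$ assume additionally that $a_j/a_i\neq-1$ for all $i,j\in\{1,\dots,k\}$. Let $c_1,\dots,c_k\in\mathbb{Q}_p\setminus\{0\}$, and let $f(x)=\sum_{i=1}^k c_ia_i^x$ for $x\in\mathbb{Z}_p$. Suppose $x_0\in\mathbb{Z}_p$ satisfies $f(x_0)=0$. Then there exist an integer $\alpha$, a positive integer $l<k$ and a non-negative integer $m$ such that for every $t\in\mathbb{Z}_p$ with $t\equiv x_0\pmod{p^m}$ one has $v_p(f(t))=\alpha+l\,v_p(t-x_0)$. In particular, $x_0$ is an isolated zero of $f$.
   Context: For $a=1+pb$ with $b\in\mathbb{Z}_p$ (and, when $p=2$, for the relevant exponents), $a^x$ for $x\in\mathbb{Z}_p$ is defined by $a^x=\sum_{j\ge0}b^j(x)_j\frac{p^j}{j!}$, where $(x)_j=x(x-1)\cdots(x-j+1)$; this is the unique continuous extension of $n\mapsto a^n$ from $\mathbb{N}$ to $\mathbb{Z}_p$ and is $p$-adic locally analytic. $v_p$ is the $p$-adic valuation ($v_p(0)=+\infty$), and $x\equiv y\pmod{p^m}$ means $v_p(x-y)\ge m$. *)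

theory Defs
  imports
    "HOL-Analysis.Analysis"
    "HOL-Computational_Algebra.Computational_Algebra"
    "Berlekamp_Zassenhaus.Finite_Field"
begin

section \<open>The p-adic absolute value on the rationals\<close>

definition rat_pval :: "nat \<Rightarrow> rat \<Rightarrow> int" where
  "rat_pval p q =
     int (multiplicity (int p) (fst (quotient_of q)))
     - int (multiplicity (int p) (snd (quotient_of q)))"

definition rat_pabs :: "nat \<Rightarrow> rat \<Rightarrow> real" where
  "rat_pabs p q = (if q = 0 then 0 else real p powi (- rat_pval p q))"

lemma rat_pval_divide:
  assumes p: "prime p" and a: "a \<noteq> 0" and b: "b \<noteq> 0"
  shows "rat_pval p (of_int a / of_int b)
    = int (multiplicity (int p) a) - int (multiplicity (int p) b)"
proof -
  obtain c d where cd: "quotient_of (of_int a / of_int b) = (c, d)"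
    by (cases "quotient_of (of_int a / of_int b)") auto
  have d: "d > 0" and eq: "(of_int a / of_int b :: rat) = of_int c / of_int d"
    using quotient_of_denom_pos[OF cd] quotient_of_div[OF cd] by auto
  have "(of_int (a * d) :: rat) = of_int (c * b)"
    using eq b d by (simp add: field_simps)
  hence *: "a * d = c * b"
    using of_int_eq_iff by blast
  have c: "c \<noteq> 0"
    using * a d by auto
  have pe: "prime_elem (int p)"
    using p by (simp add: prime_imp_prime_elem)
  have "multiplicity (int p) a + multiplicity (int p) d
      = multiplicity (int p) c + multiplicity (int p) b"
    using * a b c d pe by (metis less_numeral_extra(3) prime_elem_multiplicity_mult_distrib)
  thus ?thesis
    using cd by (simp add: rat_pval_def)
qed

lemma rat_fraction_cases:
  fixes q :: rat
  obtains a b where "q = of_int a / of_int b" and "b \<noteq> 0" and "q = 0 \<longleftrightarrow> a = 0"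
proof -
  obtain c d where cd: "quotient_of q = (c, d)"
    by (cases "quotient_of q") auto
  have "d > 0" and "q = of_int c / of_int d"
    using quotient_of_denom_pos[OF cd] quotient_of_div[OF cd] by auto
  thus ?thesis
    by (intro that[of c d]) auto
qed

lemma rat_pval_mult:
  assumes p: "prime p" and x: "x \<noteq> 0" and y: "y \<noteq> 0"
  shows "rat_pval p (x * y) = rat_pval p x + rat_pval p y"
proof -
  obtain a b where ab: "x = of_int a / of_int b" "b \<noteq> 0" "a \<noteq> 0"
    using rat_fraction_cases[of x] x by metis
  obtain c d where cd: "y = of_int c / of_int d" "d \<noteq> 0" "c \<noteq> 0"
    using rat_fraction_cases[of y] y by metis
  have pe: "prime_elem (int p)"
    using p by (simp add: prime_imp_prime_elem)
  have "x * y = of_int (a * c) / of_int (b * d)"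
    using ab cd by simp
  hence "rat_pval p (x * y)
      = int (multiplicity (int p) (a * c)) - int (multiplicity (int p) (b * d))"
    using rat_pval_divide[OF p, of "a * c" "b * d"] ab cd by simp
  thus ?thesis
    using ab cd p pe by (simp add: rat_pval_divide prime_elem_multiplicity_mult_distrib)
qed

lemma rat_pval_add:
  assumes p: "prime p" and x: "x \<noteq> 0" and y: "y \<noteq> 0" and xy: "x + y \<noteq> 0"
  shows "rat_pval p (x + y) \<ge> min (rat_pval p x) (rat_pval p y)"
proof -
  obtain a b where ab: "x = of_int a / of_int b" "b \<noteq> 0" "a \<noteq> 0"
    using rat_fraction_cases[of x] x by metis
  obtain c d where cd: "y = of_int c / of_int d" "d \<noteq> 0" "c \<noteq> 0"
    using rat_fraction_cases[of y] y by metis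
  have pe: "prime_elem (int p)"
    using p by (simp add: prime_imp_prime_elem)
  let ?m = "multiplicity (int p)"
  have eq: "x + y = of_int (a * d + c * b) / of_int (b * d)"
    using ab cd by (simp add: field_simps)
  have nz: "a * d + c * b \<noteq> 0"
    using xy unfolding eq by (intro notI) simp
  have "int p ^ min (?m (a * d)) (?m (c * b)) dvd a * d + c * b"
    by (intro dvd_add; rule multiplicity_dvd') auto
  hence "min (?m (a * d)) (?m (c * b)) \<le> ?m (a * d + c * b)"
    using nz pe by (intro multiplicity_geI) auto
  moreover have "rat_pval p (x + y) = int (?m (a * d + c * b)) - int (?m (b * d))"
    unfolding eq using rat_pval_divide[OF p nz, of "b * d"] ab cd by simp
  moreover have "?m (a * d) = ?m a + ?m d" "?m (c * b) = ?m c + ?m b" "?m (b * d) = ?m b + ?m d"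
    using ab cd pe by (simp_all add: prime_elem_multiplicity_mult_distrib)
  moreover have "rat_pval p x = int (?m a) - int (?m b)" "rat_pval p y = int (?m c) - int (?m d)"
    using ab cd p by (simp_all add: rat_pval_divide)
  ultimately show ?thesis
    by linarith
qed

lemma rat_pabs_0 [simp]: "rat_pabs p 0 = 0"
  by (simp add: rat_pabs_def)

lemma rat_pabs_pos: "prime p \<Longrightarrow> x \<noteq> 0 \<Longrightarrow> rat_pabs p x > 0"
  by (simp add: rat_pabs_def prime_gt_0_nat)

lemma rat_pabs_nonneg [simp]: "rat_pabs p x \<ge> 0"
  by (simp add: rat_pabs_def)

lemma rat_pabs_eq_0 [simp]: "prime p \<Longrightarrow> rat_pabs p x = 0 \<longleftrightarrow> x = 0"
  using rat_pabs_pos[of p x] by (cases "x = 0") auto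

lemma rat_pabs_mult: "prime p \<Longrightarrow> rat_pabs p (x * y) = rat_pabs p x * rat_pabs p y"
  by (auto simp: rat_pabs_def rat_pval_mult power_int_add power_int_minus power_int_diff
      prime_gt_0_nat field_simps)

lemma rat_pabs_1 [simp]: "rat_pabs p 1 = 1"
  by (simp add: rat_pabs_def rat_pval_def quotient_of_int[of 1, simplified])

lemma rat_pabs_minus [simp]:
  assumes p: "prime p"
  shows "rat_pabs p (- x) = rat_pabs p x"
proof -
  have "rat_pabs p (-1) * rat_pabs p (-1) = 1"
    using rat_pabs_mult[OF p, of "-1" "-1"] by simp
  hence "rat_pabs p (-1) ^ 2 = 1 ^ 2"
    by (simp add: power2_eq_square)
  hence "rat_pabs p (-1) = 1"
    using power_eq_imp_eq_base[of "rat_pabs p (-1)" 2 1] by simp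
  thus ?thesis
    using rat_pabs_mult[OF p, of "-1" x] by simp
qed

lemma rat_pabs_inverse: "prime p \<Longrightarrow> rat_pabs p (inverse x) = inverse (rat_pabs p x)"
  by (metis inverse_unique inverse_zero rat_pabs_0 rat_pabs_1 rat_pabs_mult right_inverse)

lemma rat_pabs_ultra:
  assumes p: "prime p"
  shows "rat_pabs p (x + y) \<le> max (rat_pabs p x) (rat_pabs p y)"
proof (cases "x = 0 \<or> y = 0 \<or> x + y = 0")
  case True
  thus ?thesis
    by (auto simp: le_max_iff_disj)
next
  case False
  hence "rat_pval p (x + y) \<ge> rat_pval p x \<or> rat_pval p (x + y) \<ge> rat_pval p y"
    using rat_pval_add[OF p, of x y] by linarith
  moreover have "real p \<ge> 1"
    using prime_ge_1_nat[OF p] by simp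
  ultimately show ?thesis
    using False by (auto simp: rat_pabs_def le_max_iff_disj intro!: power_int_increasing)
qed

lemma rat_pabs_minus_commute: "prime p \<Longrightarrow> rat_pabs p (x - y) = rat_pabs p (y - x)"
  by (metis minus_diff_eq rat_pabs_minus)

lemma rat_pabs_diff_ultra:
  "prime p \<Longrightarrow> rat_pabs p (x - y) \<le> max (rat_pabs p x) (rat_pabs p y)"
  using rat_pabs_ultra[of p x "- y"] by simp

lemma rat_pabs_triangle: "prime p \<Longrightarrow> rat_pabs p (x + y) \<le> rat_pabs p x + rat_pabs p y"
  using rat_pabs_ultra[of p x y] rat_pabs_nonneg[of p x] rat_pabs_nonneg[of p y] by linarith

lemma rat_pabs_diff_abs:
  assumes "prime p"
  shows "\<bar>rat_pabs p x - rat_pabs p y\<bar> \<le> rat_pabs p (x - y)"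
  using rat_pabs_triangle[OF assms, of "x - y" y] rat_pabs_triangle[OF assms, of "y - x" x]
    rat_pabs_minus_commute[OF assms, of x y] by (simp add: abs_if)

lemma rat_pabs_eq_of_close:
  assumes "prime p" and "rat_pabs p (x - y) < rat_pabs p y"
  shows "rat_pabs p x = rat_pabs p y"
  using rat_pabs_ultra[OF assms(1), of "x - y" y] rat_pabs_ultra[OF assms(1), of "y - x" x]
    rat_pabs_minus_commute[OF assms(1), of x y] assms(2) by (simp add: max_def split: if_splits)


section \<open>p-adic Cauchy sequences\<close>

definition pvanishes :: "nat \<Rightarrow> (nat \<Rightarrow> rat) \<Rightarrow> bool" where
  "pvanishes p X \<longleftrightarrow> (\<lambda>n. rat_pabs p (X n)) \<longlonglongrightarrow> 0"

definition pcauchy :: "nat \<Rightarrow> (nat \<Rightarrow> rat) \<Rightarrow> bool" where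
  "pcauchy p X \<longleftrightarrow> (\<forall>r>0. \<exists>k. \<forall>m\<ge>k. \<forall>n\<ge>k. rat_pabs p (X m - X n) < r)"

lemma pvanishes_const [simp]: "prime p \<Longrightarrow> pvanishes p (\<lambda>_. c) \<longleftrightarrow> c = 0"
  by (simp add: pvanishes_def LIMSEQ_const_iff)

lemma pvanishes_le:
  assumes "pvanishes p X" "pvanishes p Y"
    and "\<And>n. rat_pabs p (Z n) \<le> K * rat_pabs p (X n) + L * rat_pabs p (Y n)"
  shows "pvanishes p Z"
proof -
  have "(\<lambda>n. K * rat_pabs p (X n) + L * rat_pabs p (Y n)) \<longlonglongrightarrow> K * 0 + L * 0"
    by (intro tendsto_add tendsto_mult_left assms(1,2)[unfolded pvanishes_def])
  hence "(\<lambda>n. K * rat_pabs p (X n) + L * rat_pabs p (Y n)) \<longlonglongrightarrow> 0"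
    by simp
  thus ?thesis
    unfolding pvanishes_def
  proof (rule Lim_null_comparison[rotated])
    show "\<forall>\<^sub>F n in sequentially. norm (rat_pabs p (Z n))
        \<le> K * rat_pabs p (X n) + L * rat_pabs p (Y n)"
      using assms(3) by (simp add: always_eventually)
  qed
qed

lemma pvanishes_minus: "prime p \<Longrightarrow> pvanishes p X \<Longrightarrow> pvanishes p (\<lambda>n. - X n)"
  by (simp add: pvanishes_def)

lemma pvanishes_add:
  "prime p \<Longrightarrow> pvanishes p X \<Longrightarrow> pvanishes p Y \<Longrightarrow> pvanishes p (\<lambda>n. X n + Y n)"
  by (rule pvanishes_le[where K = 1 and L = 1 and X = X and Y = Y])
     (auto intro: rat_pabs_triangle)

lemma pcauchyI:
  "(\<And>r. r > 0 \<Longrightarrow> \<exists>k. \<forall>m\<ge>k. \<forall>n\<ge>k. rat_pabs p (X m - X n) < r) \<Longrightarrow> pcauchy p X"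
  by (simp add: pcauchy_def)

lemma pcauchyD:
  "pcauchy p X \<Longrightarrow> r > 0 \<Longrightarrow> \<exists>k. \<forall>m\<ge>k. \<forall>n\<ge>k. rat_pabs p (X m - X n) < r"
  by (simp add: pcauchy_def)

lemma pcauchy_const [simp]: "pcauchy p (\<lambda>_. c)"
  by (simp add: pcauchy_def)

lemma pcauchy_minus: "prime p \<Longrightarrow> pcauchy p X \<Longrightarrow> pcauchy p (\<lambda>n. - X n)"
  unfolding pcauchy_def minus_diff_minus by (simp only: rat_pabs_minus)

lemma pcauchy_le:
  assumes X: "pcauchy p X" and Y: "pcauchy p Y" and KL: "K > 0" "L > 0"
    and le: "\<And>m n. m \<ge> N \<Longrightarrow> n \<ge> N \<Longrightarrow>
      rat_pabs p (Z m - Z n) \<le> K * rat_pabs p (X m - X n) + L * rat_pabs p (Y m - Y n)"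
  shows "pcauchy p Z"
proof (rule pcauchyI)
  fix r :: real assume r: "r > 0"
  obtain i where i: "\<forall>m\<ge>i. \<forall>n\<ge>i. rat_pabs p (X m - X n) < r / (2 * K)"
    using pcauchyD[OF X, of "r / (2 * K)"] r KL by auto
  obtain j where j: "\<forall>m\<ge>j. \<forall>n\<ge>j. rat_pabs p (Y m - Y n) < r / (2 * L)"
    using pcauchyD[OF Y, of "r / (2 * L)"] r KL by auto
  have "rat_pabs p (Z m - Z n) < r" if "m \<ge> max N (max i j)" "n \<ge> max N (max i j)" for m n
  proof -
    have "rat_pabs p (X m - X n) < r / (2 * K)" "rat_pabs p (Y m - Y n) < r / (2 * L)"
      using that i j by simp_all
    hence "K * rat_pabs p (X m - X n) < K * (r / (2 * K))"
          "L * rat_pabs p (Y m - Y n) < L * (r / (2 * L))"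
      using KL by (simp_all only: mult_less_cancel_left_pos)
    thus ?thesis
      using le[of m n] that KL by simp
  qed
  thus "\<exists>k. \<forall>m\<ge>k. \<forall>n\<ge>k. rat_pabs p (Z m - Z n) < r"
    by blast
qed

lemma pcauchy_add:
  assumes p: "prime p" and "pcauchy p X" "pcauchy p Y"
  shows "pcauchy p (\<lambda>n. X n + Y n)"
proof (rule pcauchy_le[OF assms(2,3), where K = 1 and L = 1 and N = 0])
  show "rat_pabs p (X m + Y m - (X n + Y n))
      \<le> 1 * rat_pabs p (X m - X n) + 1 * rat_pabs p (Y m - Y n)" for m n
    unfolding add_diff_add using rat_pabs_triangle[OF p] by simp
qed auto

lemma pcauchy_diff:
  "prime p \<Longrightarrow> pcauchy p X \<Longrightarrow> pcauchy p Y \<Longrightarrow> pcauchy p (\<lambda>n. X n - Y n)"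
  using pcauchy_add[of p X "\<lambda>n. - Y n"] pcauchy_minus[of p Y] by simp

lemma pcauchy_Cauchy:
  assumes p: "prime p" and X: "pcauchy p X"
  shows "Cauchy (\<lambda>n. rat_pabs p (X n))"
proof (rule metric_CauchyI)
  fix r :: real assume "r > 0"
  then obtain k where "\<forall>m\<ge>k. \<forall>n\<ge>k. rat_pabs p (X m - X n) < r"
    using pcauchyD[OF X] by blast
  thus "\<exists>k. \<forall>m\<ge>k. \<forall>n\<ge>k. dist (rat_pabs p (X m)) (rat_pabs p (X n)) < r"
    using rat_pabs_diff_abs[OF p] by (metis dist_real_def le_less_trans)
qed

lemma pcauchy_bounded:
  assumes p: "prime p" and X: "pcauchy p X"
  obtains B where "B > 0" and "\<And>n. rat_pabs p (X n) \<le> B"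
proof -
  have "Bseq (\<lambda>n. rat_pabs p (X n))"
    using pcauchy_Cauchy[OF assms] by (rule Cauchy_Bseq)
  thus ?thesis
    using that by (auto simp: Bseq_def)
qed

lemma pcauchy_mult:
  assumes p: "prime p" and X: "pcauchy p X" and Y: "pcauchy p Y"
  shows "pcauchy p (\<lambda>n. X n * Y n)"
proof -
  obtain A where A: "A > 0" "\<And>n. rat_pabs p (X n) \<le> A"
    using pcauchy_bounded[OF p X] by blast
  obtain B where B: "B > 0" "\<And>n. rat_pabs p (Y n) \<le> B"
    using pcauchy_bounded[OF p Y] by blast
  show ?thesis
  proof (rule pcauchy_le[OF X Y B(1) A(1), where N = 0])
    fix m n
    have "rat_pabs p (X m * Y m - X n * Y n)
        \<le> rat_pabs p (X m) * rat_pabs p (Y m - Y n) + rat_pabs p (X m - X n) * rat_pabs p (Y n)"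
      unfolding mult_diff_mult using rat_pabs_triangle[OF p] by (simp flip: rat_pabs_mult[OF p])
    also have "\<dots> \<le> A * rat_pabs p (Y m - Y n) + rat_pabs p (X m - X n) * B"
      by (intro add_mono mult_mono A B) (auto intro: less_imp_le A B)
    finally show "rat_pabs p (X m * Y m - X n * Y n)
        \<le> B * rat_pabs p (X m - X n) + A * rat_pabs p (Y m - Y n)"
      by (simp add: mult.commute)
  qed
qed

lemma pcauchy_not_vanishes:
  assumes p: "prime p" and X: "pcauchy p X" and nv: "\<not> pvanishes p X"
  obtains k where "X k \<noteq> 0" and "\<And>n. n \<ge> k \<Longrightarrow> rat_pabs p (X n) = rat_pabs p (X k)"
proof -
  from nv obtain r where r: "r > 0" "\<And>k. \<exists>n\<ge>k. rat_pabs p (X n) \<ge> r"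
    unfolding pvanishes_def LIMSEQ_iff by (force simp: not_less)
  obtain i where i: "\<forall>m\<ge>i. \<forall>n\<ge>i. rat_pabs p (X m - X n) < r"
    using pcauchyD[OF X r(1)] by blast
  obtain k where k: "k \<ge> i" "rat_pabs p (X k) \<ge> r"
    using r(2) by blast
  show ?thesis
  proof (rule that)
    show "X k \<noteq> 0"
      using k r(1) by auto
    show "rat_pabs p (X n) = rat_pabs p (X k)" if "n \<ge> k" for n
    proof (rule rat_pabs_eq_of_close[OF p])
      show "rat_pabs p (X n - X k) < rat_pabs p (X k)"
        using i k that by (meson le_trans less_le_trans)
    qed
  qed
qed

lemma rat_pabs_inverse_diff:
  assumes p: "prime p" and "x \<noteq> 0" "y \<noteq> 0"
  shows "rat_pabs p (inverse x - inverse y)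
    = inverse (rat_pabs p x) * rat_pabs p (x - y) * inverse (rat_pabs p y)"
  using inverse_diff_inverse[OF assms(2,3)] p by (simp add: rat_pabs_mult rat_pabs_inverse)

lemma pcauchy_inverse:
  assumes p: "prime p" and X: "pcauchy p X" and nv: "\<not> pvanishes p X"
  shows "pcauchy p (\<lambda>n. inverse (X n))"
proof -
  obtain k where k: "X k \<noteq> 0" "\<And>n. n \<ge> k \<Longrightarrow> rat_pabs p (X n) = rat_pabs p (X k)"
    using pcauchy_not_vanishes[OF assms] by blast
  define c where "c = rat_pabs p (X k)"
  have c: "c > 0"
    using rat_pabs_pos[OF p k(1)] by (simp add: c_def)
  have nz: "X n \<noteq> 0" if "n \<ge> k" for n
    using k(2)[OF that] c unfolding c_def by (metis less_irrefl rat_pabs_0)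
  show ?thesis
  proof (rule pcauchy_le[OF X X, where N = k and K = "inverse c * inverse c" and L = 1])
    fix m n assume mn: "m \<ge> k" "n \<ge> k"
    show "rat_pabs p (inverse (X m) - inverse (X n))
        \<le> inverse c * inverse c * rat_pabs p (X m - X n) + 1 * rat_pabs p (X m - X n)"
      unfolding rat_pabs_inverse_diff[OF p nz[OF mn(1)] nz[OF mn(2)]]
        k(2)[OF mn(1)] k(2)[OF mn(2)] c_def[symmetric] by (simp add: mult_ac)
  qed (use c in auto)
qed


section \<open>The field of p-adic numbers\<close>

text \<open>
  The field of p-adic numbers is the completion of the rationals with respect to the p-adic
  absolute value, where the prime p is the cardinality of the type \<^typ>\<open>'p::prime_card\<close>.
  The type of Cauchy sequences is a separate type so that it carries the parameter p.
\<close>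

typedef 'p padic_seq = "{X. pcauchy CARD('p) X}"
  morphisms seq_of Seq
  by (rule exI[of _ "\<lambda>_. 0"]) simp

definition padic_rel :: "'p::prime_card padic_seq \<Rightarrow> 'p padic_seq \<Rightarrow> bool" where
  "padic_rel X Y \<longleftrightarrow> pvanishes CARD('p) (\<lambda>n. seq_of X n - seq_of Y n)"

lemma equivp_padic_rel: "equivp (padic_rel :: 'p::prime_card padic_seq \<Rightarrow> _)"
proof (rule equivpI)
  note p = prime_card[where 'a = 'p]
  show "reflp (padic_rel :: 'p padic_seq \<Rightarrow> _)"
    by (simp add: reflp_def padic_rel_def p)
  show "symp (padic_rel :: 'p padic_seq \<Rightarrow> _)"
    by (simp add: symp_def padic_rel_def pvanishes_def rat_pabs_minus_commute[OF p])
  show "transp (padic_rel :: 'p padic_seq \<Rightarrow> _)"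
  proof (rule transpI)
    fix X Y Z :: "'p padic_seq"
    assume "padic_rel X Y" "padic_rel Y Z"
    from pvanishes_add[OF p this[unfolded padic_rel_def]] show "padic_rel X Z"
      by (simp add: padic_rel_def)
  qed
qed

quotient_type 'p padic = "'p::prime_card padic_seq" / padic_rel
  by (rule equivp_padic_rel)

lemma pcauchy_seq_of [simp]: "pcauchy CARD('p) (seq_of (X :: 'p padic_seq))"
  using seq_of[of X] by simp

lemma seq_of_Seq [simp]: "pcauchy CARD('p) X \<Longrightarrow> seq_of (Seq X :: 'p padic_seq) = X"
  by (simp add: Seq_inverse)

definition Padic :: "(nat \<Rightarrow> rat) \<Rightarrow> 'p::prime_card padic" where
  "Padic X = abs_padic (Seq X)"

lemma Padic_induct [induct type: padic]:
  assumes "\<And>X. pcauchy CARD('p) X \<Longrightarrow> P (Padic X)"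
  shows "P (x :: 'p::prime_card padic)"
proof -
  obtain Y where Y: "x = abs_padic Y"
    by (metis Quotient3_abs_rep Quotient3_padic)
  have "P (Padic (seq_of Y))"
    by (rule assms) simp
  thus ?thesis
    by (simp add: Y Padic_def seq_of_inverse)
qed

lemma eq_Padic:
  "pcauchy CARD('p) X \<Longrightarrow> pcauchy CARD('p) Y \<Longrightarrow>
    (Padic X :: 'p::prime_card padic) = Padic Y \<longleftrightarrow> pvanishes CARD('p) (\<lambda>n. X n - Y n)"
  by (simp add: Padic_def padic.abs_eq_iff padic_rel_def)

instantiation padic :: (prime_card) field
begin

lift_definition zero_padic :: "'a padic" is "Seq (\<lambda>_. 0)" .

lift_definition one_padic :: "'a padic" is "Seq (\<lambda>_. 1)" .

lift_definition plus_padic :: "'a padic \<Rightarrow> 'a padic \<Rightarrow> 'a padic"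
  is "\<lambda>X Y. Seq (\<lambda>n. seq_of X n + seq_of Y n)"
proof -
  fix X X' Y Y' :: "'a padic_seq"
  note p = prime_card[where 'a = 'a]
  assume *: "padic_rel X X'" "padic_rel Y Y'"
  have "pvanishes CARD('a) (\<lambda>n. (seq_of X n + seq_of Y n) - (seq_of X' n + seq_of Y' n))"
    using pvanishes_add[OF p *[unfolded padic_rel_def]] by (simp only: add_diff_add)
  thus "padic_rel (Seq (\<lambda>n. seq_of X n + seq_of Y n) :: 'a padic_seq)
      (Seq (\<lambda>n. seq_of X' n + seq_of Y' n))"
    by (simp only: padic_rel_def pcauchy_add[OF p] pcauchy_seq_of seq_of_Seq)
qed

lift_definition uminus_padic :: "'a padic \<Rightarrow> 'a padic"
  is "\<lambda>X. Seq (\<lambda>n. - seq_of X n)"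
  unfolding padic_rel_def
  by (simp only: prime_card pcauchy_minus pcauchy_seq_of seq_of_Seq minus_diff_minus
      pvanishes_minus)

lift_definition times_padic :: "'a padic \<Rightarrow> 'a padic \<Rightarrow> 'a padic"
  is "\<lambda>X Y. Seq (\<lambda>n. seq_of X n * seq_of Y n)"
proof -
  fix X X' Y Y' :: "'a padic_seq"
  note p = prime_card[where 'a = 'a]
  assume *: "padic_rel X X'" "padic_rel Y Y'"
  obtain A where A: "A > 0" "\<And>n. rat_pabs CARD('a) (seq_of X n) \<le> A"
    using pcauchy_bounded[OF p pcauchy_seq_of[of X]] by blast
  obtain B where B: "B > 0" "\<And>n. rat_pabs CARD('a) (seq_of Y' n) \<le> B"
    using pcauchy_bounded[OF p pcauchy_seq_of[of Y']] by blast
  have "pvanishes CARD('a) (\<lambda>n. seq_of X n * seq_of Y n - seq_of X' n * seq_of Y' n)"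
  proof (rule pvanishes_le[where K = B and L = A])
    fix n
    have "rat_pabs CARD('a) (seq_of X n * seq_of Y n - seq_of X' n * seq_of Y' n)
        \<le> rat_pabs CARD('a) (seq_of X n) * rat_pabs CARD('a) (seq_of Y n - seq_of Y' n)
          + rat_pabs CARD('a) (seq_of X n - seq_of X' n) * rat_pabs CARD('a) (seq_of Y' n)"
      unfolding mult_diff_mult using rat_pabs_triangle[OF p] by (simp flip: rat_pabs_mult[OF p])
    also have "\<dots> \<le> A * rat_pabs CARD('a) (seq_of Y n - seq_of Y' n)
        + rat_pabs CARD('a) (seq_of X n - seq_of X' n) * B"
      by (intro add_mono mult_mono A B) (auto intro: less_imp_le A B)
    finally show "rat_pabs CARD('a) (seq_of X n * seq_of Y n - seq_of X' n * seq_of Y' n)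
        \<le> B * rat_pabs CARD('a) (seq_of X n - seq_of X' n)
          + A * rat_pabs CARD('a) (seq_of Y n - seq_of Y' n)"
      by (simp add: mult.commute)
  qed (use * in \<open>auto simp: padic_rel_def\<close>)
  thus "padic_rel (Seq (\<lambda>n. seq_of X n * seq_of Y n) :: 'a padic_seq)
      (Seq (\<lambda>n. seq_of X' n * seq_of Y' n))"
    by (simp add: padic_rel_def pcauchy_mult[OF p])
qed

lift_definition inverse_padic :: "'a padic \<Rightarrow> 'a padic"
  is "\<lambda>X. if pvanishes CARD('a) (seq_of X) then Seq (\<lambda>_. 0) else Seq (\<lambda>n. inverse (seq_of X n))"
proof -
  fix X' Y' :: "'a padic_seq"
  note p = prime_card[where 'a = 'a]
  assume *: "padic_rel X' Y'"
  define X Y where "X = seq_of X'" and "Y = seq_of Y'"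
  have X: "pcauchy CARD('a) X" and Y: "pcauchy CARD('a) Y"
    and XY: "pvanishes CARD('a) (\<lambda>n. X n - Y n)"
    using * by (auto simp: padic_rel_def X_def Y_def)
  have iff: "pvanishes CARD('a) X \<longleftrightarrow> pvanishes CARD('a) Y"
  proof
    assume "pvanishes CARD('a) X"
    with pvanishes_add[OF p this pvanishes_minus[OF p XY]] show "pvanishes CARD('a) Y"
      by simp
  next
    assume "pvanishes CARD('a) Y"
    with pvanishes_add[OF p this XY] show "pvanishes CARD('a) X"
      by simp
  qed
  have "pvanishes CARD('a) (\<lambda>n. inverse (X n) - inverse (Y n))" if nv: "\<not> pvanishes CARD('a) X"
  proof -
    obtain k where k: "X k \<noteq> 0" "\<And>n. n \<ge> k \<Longrightarrow> rat_pabs CARD('a) (X n) = rat_pabs CARD('a) (X k)"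
      using pcauchy_not_vanishes[OF p X nv] by blast
    obtain l where l: "Y l \<noteq> 0" "\<And>n. n \<ge> l \<Longrightarrow> rat_pabs CARD('a) (Y n) = rat_pabs CARD('a) (Y l)"
      using pcauchy_not_vanishes[OF p Y] nv iff by blast
    let ?f = "\<lambda>n. inverse (rat_pabs CARD('a) (X k)) * rat_pabs CARD('a) (X n - Y n)
      * inverse (rat_pabs CARD('a) (Y l))"
    have "?f \<longlonglongrightarrow> inverse (rat_pabs CARD('a) (X k)) * 0 * inverse (rat_pabs CARD('a) (Y l))"
      using XY unfolding pvanishes_def by (intro tendsto_mult tendsto_const)
    hence "?f \<longlonglongrightarrow> 0"
      by simp
    moreover have "eventually (\<lambda>n. ?f n = rat_pabs CARD('a) (inverse (X n) - inverse (Y n))) sequentially"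
      using eventually_ge_at_top[of "max k l"]
    proof eventually_elim
      case (elim n)
      hence "X n \<noteq> 0" "Y n \<noteq> 0"
        using k(1) k(2)[of n] l(1) l(2)[of n] p by (metis max.bounded_iff rat_pabs_eq_0)+
      thus ?case
        using elim k(2)[of n] l(2)[of n] p by (simp add: rat_pabs_inverse_diff)
    qed
    ultimately show ?thesis
      unfolding pvanishes_def by (rule Lim_transform_eventually)
  qed
  thus "padic_rel
      (if pvanishes CARD('a) (seq_of X') then Seq (\<lambda>_. 0)
       else Seq (\<lambda>n. inverse (seq_of X' n)) :: 'a padic_seq)
      (if pvanishes CARD('a) (seq_of Y') then Seq (\<lambda>_. 0) else Seq (\<lambda>n. inverse (seq_of Y' n)))"
    using iff X Y unfolding X_def[symmetric] Y_def[symmetric]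
    by (simp add: padic_rel_def pcauchy_inverse[OF p] p)
qed

definition "x - y = x + - y" for x y :: "'a padic"

definition "x div y = x * inverse y" for x y :: "'a padic"

lemma zero_Padic: "(0 :: 'a padic) = Padic (\<lambda>_. 0)"
  by (simp add: zero_padic_def Padic_def)

lemma one_Padic: "(1 :: 'a padic) = Padic (\<lambda>_. 1)"
  by (simp add: one_padic_def Padic_def)

lemma add_Padic:
  "pcauchy CARD('a) X \<Longrightarrow> pcauchy CARD('a) Y \<Longrightarrow>
    (Padic X + Padic Y :: 'a padic) = Padic (\<lambda>n. X n + Y n)"
  by (simp add: Padic_def plus_padic.abs_eq)

lemma minus_Padic:
  "pcauchy CARD('a) X \<Longrightarrow> (- Padic X :: 'a padic) = Padic (\<lambda>n. - X n)"
  by (simp add: Padic_def uminus_padic.abs_eq)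

lemma mult_Padic:
  "pcauchy CARD('a) X \<Longrightarrow> pcauchy CARD('a) Y \<Longrightarrow>
    (Padic X * Padic Y :: 'a padic) = Padic (\<lambda>n. X n * Y n)"
  by (simp add: Padic_def times_padic.abs_eq)

lemma inverse_Padic:
  "pcauchy CARD('a) X \<Longrightarrow> (inverse (Padic X) :: 'a padic)
    = (if pvanishes CARD('a) X then 0 else Padic (\<lambda>n. inverse (X n)))"
  by (simp add: Padic_def zero_padic_def inverse_padic.abs_eq)

instance
proof
  note p = prime_card[where 'a = 'a]
  note [simp] = add_Padic mult_Padic minus_Padic zero_Padic one_Padic
    pcauchy_add[OF p] pcauchy_mult[OF p] pcauchy_minus[OF p]
  fix a b c :: "'a padic"
  show "a + b = b + a"
    by (induction a, induction b) (simp add: ac_simps)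
  show "(a + b) + c = a + (b + c)"
    by (induction a, induction b, induction c) (simp add: ac_simps)
  show "0 + a = a"
    by (induction a) simp
  show "- a + a = 0"
    by (induction a) simp
  show "a - b = a + - b"
    by (rule minus_padic_def)
  show "(a * b) * c = a * (b * c)"
    by (induction a, induction b, induction c) (simp add: ac_simps)
  show "a * b = b * a"
    by (induction a, induction b) (simp add: ac_simps)
  show "1 * a = a"
    by (induction a) simp
  show "(a + b) * c = a * c + b * c"
    by (induction a, induction b, induction c) (simp add: distrib_right)
  show "(0 :: 'a padic) \<noteq> 1"
    by (simp add: eq_Padic p)
  show "a div b = a * inverse b"
    by (rule divide_padic_def)
  show "inverse (0 :: 'a padic) = 0"
    by (simp add: inverse_Padic p)
  show "a \<noteq> 0 \<Longrightarrow> inverse a * a = 1"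
  proof (induction a)
    fix X assume X: "pcauchy CARD('a) X" and "(Padic X :: 'a padic) \<noteq> 0"
    hence nv: "\<not> pvanishes CARD('a) X"
      by (simp add: eq_Padic)
    obtain k where k: "X k \<noteq> 0" "\<And>n. n \<ge> k \<Longrightarrow> rat_pabs CARD('a) (X n) = rat_pabs CARD('a) (X k)"
      using pcauchy_not_vanishes[OF p X nv] by blast
    have "X n \<noteq> 0" if "n \<ge> k" for n
      using k(1) k(2)[OF that] p by (metis rat_pabs_eq_0)
    hence "eventually (\<lambda>n. rat_pabs CARD('a) (inverse (X n) * X n - 1) = 0) sequentially"
      by (auto simp: eventually_sequentially p intro!: exI[of _ k])
    hence "pvanishes CARD('a) (\<lambda>n. inverse (X n) * X n - 1)"
      unfolding pvanishes_def by (rule tendsto_eventually)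
    thus "inverse (Padic X :: 'a padic) * Padic X = 1"
      using X nv by (simp add: inverse_Padic eq_Padic pcauchy_inverse[OF p])
  qed
qed

end

lemma diff_Padic:
  "pcauchy CARD('p) X \<Longrightarrow> pcauchy CARD('p) Y \<Longrightarrow>
    (Padic X - Padic Y :: 'p::prime_card padic) = Padic (\<lambda>n. X n - Y n)"
  by (simp add: minus_padic_def minus_Padic add_Padic pcauchy_minus prime_card)

lemma of_nat_Padic: "(of_nat n :: 'p::prime_card padic) = Padic (\<lambda>_. of_nat n)"
  by (induction n) (simp_all add: zero_Padic one_Padic add_Padic)

instance padic :: (prime_card) field_char_0
proof
  show "inj (of_nat :: nat \<Rightarrow> 'a padic)"
    by (rule injI) (simp add: of_nat_Padic eq_Padic prime_card)
qed

lemma of_int_Padic: "(of_int z :: 'p::prime_card padic) = Padic (\<lambda>_. of_int z)"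
  by (cases z rule: int_diff_cases) (simp add: of_nat_Padic diff_Padic)

lemma of_rat_Padic: "(of_rat q :: 'p::prime_card padic) = Padic (\<lambda>_. q)"
proof -
  obtain a b where ab: "q = of_int a / of_int b" "b \<noteq> 0"
    using rat_fraction_cases[of q] by metis
  have "(of_rat q :: 'p padic) = of_int a * inverse (of_int b)"
    unfolding ab(1) of_rat_divide of_rat_of_int_eq by (rule divide_inverse)
  also have "\<dots> = Padic (\<lambda>_. q)"
    using ab by (simp add: of_int_Padic inverse_Padic mult_Padic prime_card divide_inverse)
  finally show ?thesis .
qed


section \<open>Absolute value, metric and completeness\<close>

text \<open>
  The library restricts \<^const>\<open>norm\<close> to real normed vector spaces, hence the separate constant.
\<close>

lift_definition padic_abs :: "'a::prime_card padic \<Rightarrow> real"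
  is "\<lambda>X. lim (\<lambda>n. rat_pabs CARD('a) (seq_of X n))"
proof -
  fix X Y :: "'a padic_seq"
  note p = prime_card[where 'a = 'a]
  assume *: "padic_rel X Y"
  have Y: "(\<lambda>n. rat_pabs CARD('a) (seq_of Y n)) \<longlonglongrightarrow> lim (\<lambda>n. rat_pabs CARD('a) (seq_of Y n))"
    using pcauchy_Cauchy[OF p pcauchy_seq_of[of Y]]
    by (simp add: Cauchy_convergent_iff convergent_LIMSEQ_iff)
  have "(\<lambda>n. rat_pabs CARD('a) (seq_of X n) - rat_pabs CARD('a) (seq_of Y n)) \<longlonglongrightarrow> 0"
  proof (rule Lim_null_comparison)
    show "(\<lambda>n. rat_pabs CARD('a) (seq_of X n - seq_of Y n)) \<longlonglongrightarrow> 0"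
      using * by (simp add: padic_rel_def pvanishes_def)
  qed (simp add: rat_pabs_diff_abs[OF p])
  from tendsto_add[OF this Y]
  have "(\<lambda>n. rat_pabs CARD('a) (seq_of X n)) \<longlonglongrightarrow> lim (\<lambda>n. rat_pabs CARD('a) (seq_of Y n))"
    by simp
  thus "lim (\<lambda>n. rat_pabs CARD('a) (seq_of X n)) = lim (\<lambda>n. rat_pabs CARD('a) (seq_of Y n))"
    by (rule limI)
qed

lemma padic_abs_LIMSEQ:
  assumes "pcauchy CARD('p) X"
  shows "(\<lambda>n. rat_pabs CARD('p) (X n)) \<longlonglongrightarrow> padic_abs (Padic X :: 'p::prime_card padic)"
proof -
  have "padic_abs (Padic X :: 'p padic) = lim (\<lambda>n. rat_pabs CARD('p) (X n))"
    using assms by (simp add: Padic_def padic_abs.abs_eq)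
  thus ?thesis
    using pcauchy_Cauchy[OF prime_card assms]
    by (simp add: Cauchy_convergent_iff convergent_LIMSEQ_iff)
qed

lemma padic_abs_of_rat: "padic_abs (of_rat q :: 'p::prime_card padic) = rat_pabs CARD('p) q"
  using padic_abs_LIMSEQ[of "\<lambda>_. q", where 'p = 'p]
  by (simp add: of_rat_Padic LIMSEQ_const_iff)

lemma padic_abs_nonneg [simp]: "padic_abs (x :: 'p::prime_card padic) \<ge> 0"
  by (induction x) (rule LIMSEQ_le_const[OF padic_abs_LIMSEQ], auto)

lemma padic_abs_eq_0 [simp]: "padic_abs (x :: 'p::prime_card padic) = 0 \<longleftrightarrow> x = 0"
proof (induction x)
  fix X assume X: "pcauchy CARD('p) X"
  have "(Padic X :: 'p padic) = 0 \<longleftrightarrow> pvanishes CARD('p) X"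
    using X by (simp add: zero_Padic eq_Padic)
  thus "padic_abs (Padic X :: 'p padic) = 0 \<longleftrightarrow> (Padic X :: 'p padic) = 0"
    using padic_abs_LIMSEQ[OF X] LIMSEQ_unique by (auto simp: pvanishes_def)
qed

lemma padic_abs_mult: "padic_abs (x * y :: 'p::prime_card padic) = padic_abs x * padic_abs y"
proof (induction x, induction y)
  fix X Y assume *: "pcauchy CARD('p) X" "pcauchy CARD('p) Y"
  have "(\<lambda>n. rat_pabs CARD('p) (X n * Y n)) \<longlonglongrightarrow> padic_abs (Padic X :: 'p padic) * padic_abs (Padic Y :: 'p padic)"
    using tendsto_mult[OF padic_abs_LIMSEQ[OF *(1)] padic_abs_LIMSEQ[OF *(2)]]
    by (simp add: rat_pabs_mult prime_card)
  thus "padic_abs (Padic X * Padic Y :: 'p padic) = padic_abs (Padic X :: 'p padic) * padic_abs (Padic Y :: 'p padic)"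
    using * padic_abs_LIMSEQ[OF pcauchy_mult[OF prime_card *]]
    by (simp add: mult_Padic LIMSEQ_unique)
qed

lemma padic_abs_ultra: "padic_abs (x + y :: 'p::prime_card padic) \<le> max (padic_abs x) (padic_abs y)"
proof (induction x, induction y)
  fix X Y assume *: "pcauchy CARD('p) X" "pcauchy CARD('p) Y"
  have "padic_abs (Padic (\<lambda>n. X n + Y n) :: 'p padic) \<le> max (padic_abs (Padic X :: 'p padic)) (padic_abs (Padic Y :: 'p padic))"
    by (rule LIMSEQ_le[OF padic_abs_LIMSEQ tendsto_max[OF padic_abs_LIMSEQ padic_abs_LIMSEQ]])
       (use * in \<open>auto simp: pcauchy_add prime_card rat_pabs_ultra\<close>)
  thus "padic_abs (Padic X + Padic Y :: 'p padic) \<le> max (padic_abs (Padic X :: 'p padic)) (padic_abs (Padic Y :: 'p padic))"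
    using * by (simp add: add_Padic)
qed

lemma padic_abs_minus [simp]: "padic_abs (- x :: 'p::prime_card padic) = padic_abs x"
proof -
  have "padic_abs (-1 :: 'p padic) = 1"
    using padic_abs_of_rat[of "-1", where 'p = 'p] by (simp add: prime_card of_rat_minus)
  thus ?thesis
    using padic_abs_mult[of "-1" x] by simp
qed

lemma padic_abs_triangle: "padic_abs (x + y :: 'p::prime_card padic) \<le> padic_abs x + padic_abs y"
  using padic_abs_ultra[of x y] padic_abs_nonneg[of x] padic_abs_nonneg[of y] by linarith

lemma padic_abs_powi:
  assumes "(x :: 'p::prime_card padic) \<noteq> 0"
  shows "\<exists>n::int. padic_abs x = real CARD('p) powi (- n)"
  using assms
proof (induction x)
  fix X assume X: "pcauchy CARD('p) X" and nz: "(Padic X :: 'p padic) \<noteq> 0"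
  have "\<not> pvanishes CARD('p) X"
    using X nz by (simp add: zero_Padic eq_Padic)
  then obtain k where k: "X k \<noteq> 0" "\<And>n. n \<ge> k \<Longrightarrow> rat_pabs CARD('p) (X n) = rat_pabs CARD('p) (X k)"
    using pcauchy_not_vanishes[OF prime_card X] by blast
  have "(\<lambda>n. rat_pabs CARD('p) (X n)) \<longlonglongrightarrow> rat_pabs CARD('p) (X k)"
    by (intro tendsto_eventually eventually_sequentiallyI[of k] k(2))
  hence "padic_abs (Padic X :: 'p padic) = rat_pabs CARD('p) (X k)"
    using padic_abs_LIMSEQ[OF X] LIMSEQ_unique by blast
  thus "\<exists>n::int. padic_abs (Padic X :: 'p padic) = real CARD('p) powi (- n)"
    using k(1) by (auto simp: rat_pabs_def)
qed

instantiation padic :: (prime_card) metric_space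
begin

definition "dist x y = padic_abs (x - y)" for x y :: "'a padic"

definition "uniformity = (INF e\<in>{0<..}. principal {(x :: 'a padic, y). dist x y < e})"

definition "open U \<longleftrightarrow> (\<forall>x\<in>U. eventually (\<lambda>(x', y). x' = x \<longrightarrow> y \<in> U) uniformity)"
  for U :: "'a padic set"

instance
proof
  fix x y z :: "'a padic"
  show "dist x y = 0 \<longleftrightarrow> x = y"
    by (simp add: dist_padic_def)
  show "dist x y \<le> dist x z + dist y z"
    using padic_abs_triangle[of "x - z" "z - y"] padic_abs_minus[of "y - z"]
    by (simp add: dist_padic_def)
qed (simp_all add: uniformity_padic_def open_padic_def)

end

lemma padic_rat_dense:
  assumes "e > 0"
  shows "\<exists>q. dist (x :: 'p::prime_card padic) (of_rat q) < e"
proof (induction x)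
  fix X assume X: "pcauchy CARD('p) X"
  obtain k where k: "\<forall>m\<ge>k. \<forall>n\<ge>k. rat_pabs CARD('p) (X m - X n) < e / 2"
    using pcauchyD[OF X, of "e / 2"] assms by auto
  have "padic_abs (Padic (\<lambda>n. X n - X k) :: 'p padic) \<le> e / 2"
    by (rule LIMSEQ_le_const2[OF padic_abs_LIMSEQ])
       (use X k in \<open>auto simp: pcauchy_diff prime_card intro!: exI[of _ k] less_imp_le\<close>)
  hence "dist (Padic X :: 'p padic) (of_rat (X k)) < e"
    using X assms by (simp add: dist_padic_def of_rat_Padic diff_Padic)
  thus "\<exists>q. dist (Padic X :: 'p padic) (of_rat q) < e" ..
qed

instance padic :: (prime_card) complete_space
proof
  fix S :: "nat \<Rightarrow> 'a padic" assume S: "Cauchy S"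
  note p = prime_card[where 'a = 'a]
  have "\<forall>n. \<exists>q. dist (S n) (of_rat q) < inverse (real (Suc n))"
    by (intro allI padic_rat_dense) simp
  then obtain X where X: "\<And>n. dist (S n) (of_rat (X n)) < inverse (real (Suc n))"
    by metis
  have lim0: "(\<lambda>n. dist (S n) (of_rat (X n))) \<longlonglongrightarrow> 0"
    by (rule tendsto_sandwich[OF _ _ tendsto_const LIMSEQ_inverse_real_of_nat])
       (auto intro!: always_eventually less_imp_le X simp del: of_nat_Suc)
  have pabs: "rat_pabs CARD('a) (X m - X n) = dist (of_rat (X m) :: 'a padic) (of_rat (X n))" for m n
    by (simp add: dist_padic_def padic_abs_of_rat flip: of_rat_diff)
  have cX: "pcauchy CARD('a) X"
  proof (rule pcauchyI)
    fix r :: real assume r: "r > 0"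
    obtain i where i: "\<And>m n. m \<ge> i \<Longrightarrow> n \<ge> i \<Longrightarrow> dist (S m) (S n) < r / 3"
      using metric_CauchyD[OF S, of "r / 3"] r by auto
    obtain j where j: "\<And>n. n \<ge> j \<Longrightarrow> dist (S n) (of_rat (X n)) < r / 3"
      using metric_LIMSEQ_D[OF lim0, of "r / 3"] r by auto
    have "rat_pabs CARD('a) (X m - X n) < r" if "m \<ge> max i j" "n \<ge> max i j" for m n
      unfolding pabs
      by (rule dist_triangle_third[of _ "S m" _ "S n"])
         (use i[of m n] j[of m] j[of n] that in \<open>auto simp: dist_commute\<close>)
    thus "\<exists>k. \<forall>m\<ge>k. \<forall>n\<ge>k. rat_pabs CARD('a) (X m - X n) < r"
      by blast
  qed
  define x :: "'a padic" where "x = Padic X"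
  have limX: "(\<lambda>n. of_rat (X n)) \<longlonglongrightarrow> x"
  proof (rule metric_LIMSEQ_I)
    fix r :: real assume r: "r > 0"
    obtain k where k: "\<forall>m\<ge>k. \<forall>n\<ge>k. rat_pabs CARD('a) (X m - X n) < r / 2"
      using pcauchyD[OF cX, of "r / 2"] r by auto
    have "dist (of_rat (X n)) x < r" if "n \<ge> k" for n
    proof -
      have "padic_abs (Padic (\<lambda>m. X n - X m) :: 'a padic) \<le> r / 2"
        by (rule LIMSEQ_le_const2[OF padic_abs_LIMSEQ])
           (use that cX k in \<open>auto simp: pcauchy_diff p intro!: exI[of _ k] less_imp_le\<close>)
      thus ?thesis
        using cX r by (simp add: x_def dist_padic_def of_rat_Padic diff_Padic)
    qed
    thus "\<exists>k. \<forall>n\<ge>k. dist (of_rat (X n)) x < r"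
      by blast
  qed
  have "(\<lambda>n. dist (S n) x) \<longlonglongrightarrow> 0"
  proof (rule tendsto_sandwich[OF _ _ tendsto_const])
    show "(\<lambda>n. dist (S n) (of_rat (X n)) + dist (of_rat (X n)) x) \<longlonglongrightarrow> 0"
      using tendsto_add[OF lim0 iffD1[OF tendsto_dist_iff limX]] by simp
  qed (auto intro!: always_eventually dist_triangle)
  thus "convergent S"
    unfolding convergent_def using tendsto_dist_iff by blast
qed


section \<open>Valuation, p-adic integers and p-adic powers\<close>

lemma log_powi: "b > 1 \<Longrightarrow> log b (b powi n) = real_of_int n"
  using log_powr_cancel[of b "real_of_int n"] by (simp add: powr_real_of_int')

text \<open>
  The valuation is read off the absolute value, which is p to the power of minus the valuation;
  it is integral away from 0 (\<open>padic_val_eq_of_int\<close>) and extends the valuation of the rationals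
  (\<open>padic_val_of_rat\<close>).
\<close>

definition padic_val :: "'p::prime_card padic \<Rightarrow> ereal" where
  "padic_val x = (if x = 0 then \<infinity> else ereal (- log (real CARD('p)) (padic_abs x)))"

lemma padic_val_eq_of_int:
  assumes "(x :: 'p::prime_card padic) \<noteq> 0"
  shows "\<exists>n::int. padic_val x = ereal (real_of_int n) \<and> padic_abs x = real CARD('p) powi (- n)"
proof -
  obtain n :: int where n: "padic_abs x = real CARD('p) powi (- n)"
    using padic_abs_powi[OF assms] by blast
  have "real CARD('p) > 1"
    using prime_gt_1_nat[OF prime_card[where 'a = 'p]] by simp
  thus ?thesis
    using n assms by (auto simp: padic_val_def log_powi intro!: exI[of _ n])
qed

lemma padic_val_of_rat:
  assumes "q \<noteq> 0"
  shows "padic_val (of_rat q :: 'p::prime_card padic) = ereal (real_of_int (rat_pval CARD('p) q))"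
proof -
  have "real CARD('p) > 1"
    using prime_gt_1_nat[OF prime_card[where 'a = 'p]] by simp
  thus ?thesis
    using assms by (simp add: padic_val_def padic_abs_of_rat rat_pabs_def log_powi)
qed

definition padic_integers :: "'p::prime_card padic set" where
  "padic_integers = {x. padic_val x \<ge> 0}"

text \<open>\<open>padic_cong m x y\<close> is the congruence of x and y modulo the m-th power of p.\<close>

definition padic_cong :: "nat \<Rightarrow> 'p::prime_card padic \<Rightarrow> 'p padic \<Rightarrow> bool" where
  "padic_cong m x y \<longleftrightarrow> padic_val (x - y) \<ge> ereal (real m)"

text \<open>
  For a = 1 + p b with a p-adic integer b, the power with exponent x is the sum of
  \<open>b ^ j * (x)\<^sub>j * p ^ j / j!\<close>, where \<open>(x)\<^sub>j\<close> is the falling factorial.  It is meant only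
  for a congruent to 1 modulo p and for a p-adic integer x, where the series converges.
\<close>

definition padic_powr :: "'p::prime_card padic \<Rightarrow> 'p padic \<Rightarrow> 'p padic" where
  "padic_powr a x =
     (let b = (a - 1) / of_nat CARD('p)
      in \<Sum>j. b ^ j * (\<Prod>i<j. x - of_nat i) * (of_nat CARD('p) ^ j / fact j))"

lemma padic_powr_of_nat: "padic_powr a (of_nat n) = (a :: 'p::prime_card padic) ^ n"
proof -
  have p: "(of_nat CARD('p) :: 'p padic) \<noteq> 0"
    using prime_gt_0_nat[OF prime_card[where 'a = 'p]] by simp
  define b where "b = (a - 1) / of_nat CARD('p)"
  have a: "a = of_nat CARD('p) * b + 1"
    using p by (simp add: b_def)
  have "(of_nat (n choose j) :: 'p padic) = (\<Prod>i<j. of_nat n - of_nat i) / fact j" for j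
    by (simp add: binomial_gbinomial gbinomial_prod_rev atLeast0LessThan)
  hence term_eq: "b ^ j * (\<Prod>i<j. of_nat n - of_nat i) * (of_nat CARD('p) ^ j / fact j)
      = of_nat (n choose j) * (of_nat CARD('p) * b) ^ j" for j
    by (simp add: power_mult_distrib)
  have "padic_powr a (of_nat n) = (\<Sum>j. of_nat (n choose j) * (of_nat CARD('p) * b) ^ j)"
    unfolding padic_powr_def Let_def b_def[symmetric] term_eq ..
  also have "\<dots> = (\<Sum>j\<le>n. of_nat (n choose j) * (of_nat CARD('p) * b) ^ j)"
    by (rule suminf_finite) (auto simp: binomial_eq_0)
  also have "\<dots> = a ^ n"
    unfolding a binomial_ring by simp
  finally show ?thesis .
qed

end

theory Submission
  imports Defs
begin

text \<open>
  Put \<open>\<pi> = p ^ (k + 1)\<close>. For s in the p-adic integers, \<open>f (x0 + \<pi> s) = \<Sum>i. d i * A i ^ s\<close> with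
  \<open>d i = c i * a i ^ x0 \<noteq> 0\<close> and \<open>A i = a i ^ \<pi> = 1 + \<pi> * v i\<close>, where the \<open>v i\<close> are p-adic integers.
  They are distinct, because 1 is the only root of unity of p-power order congruent to 1 modulo p,
  apart from \<open>-1\<close> when \<open>p = 2\<close>. The binomial series gives
  \<open>f (x0 + \<pi> s) = \<Sum>j. h j * (s)\<^sub>j\<close> with \<open>h j = \<pi> ^ j / j! * z j\<close> and \<open>z j = \<Sum>i. d i * v i ^ j\<close>.
  By a linear recurrence the maximum of \<open>\<bar>z j\<bar>\<close> is attained, and nonzero, at some index below k;
  the powers of \<open>\<pi>\<close> then force the last index J at which \<open>\<bar>h j\<bar>\<close> is maximal below k as well.
  As falling factorials are monic with integral coefficients, the J-th Taylor coefficient of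
  \<open>f (x0 + \<pi> s)\<close> in s has absolute value \<open>\<bar>h J\<bar> \<noteq> 0\<close>. So the order of vanishing at \<open>s = 0\<close>
  is at most \<open>J < k\<close>. This uses no p-adic logarithm.
\<close>

hide_const (open) up_ring.coeff module.smult

section \<open>The p-adic absolute value\<close>

lemma CARD_gt_1: "real CARD('p::prime_card) > 1"
  using prime_gt_1_nat[OF prime_card[where 'a = 'p]] by simp

lemma padic_abs_0 [simp]: "padic_abs (0 :: 'p::prime_card padic) = 0"
  by simp

lemma padic_abs_pos_iff [simp]: "padic_abs (x :: 'p::prime_card padic) > 0 \<longleftrightarrow> x \<noteq> 0"
  using padic_abs_nonneg[of x] padic_abs_eq_0[of x] by linarith

lemma padic_abs_of_int_eq_rat: "padic_abs (of_int z :: 'p::prime_card padic) = rat_pabs CARD('p) (of_int z)"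
  using padic_abs_of_rat[of "of_int z", where 'p = 'p] by simp

lemma padic_abs_1 [simp]: "padic_abs (1 :: 'p::prime_card padic) = 1"
  using padic_abs_of_int_eq_rat[of 1, where 'p = 'p] by simp

lemma padic_abs_power: "padic_abs (x ^ n :: 'p::prime_card padic) = padic_abs x ^ n"
  by (induction n) (simp_all add: padic_abs_mult)

lemma padic_abs_divide:
  "padic_abs (x / y :: 'p::prime_card padic) = padic_abs x / padic_abs y"
proof (cases "y = 0")
  case False
  then have "padic_abs (x / y) * padic_abs y = padic_abs x"
    by (simp flip: padic_abs_mult)
  with False show ?thesis
    by (simp add: field_simps)
qed simp

lemma padic_abs_minus_commute: "padic_abs (x - y :: 'p::prime_card padic) = padic_abs (y - x)"
  by (metis minus_diff_eq padic_abs_minus)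

lemma padic_abs_add_le:
  "padic_abs x \<le> B \<Longrightarrow> padic_abs y \<le> B \<Longrightarrow> padic_abs (x + y :: 'p::prime_card padic) \<le> B"
  using padic_abs_ultra[of x y] by simp

lemma padic_abs_diff_le:
  "padic_abs x \<le> B \<Longrightarrow> padic_abs y \<le> B \<Longrightarrow> padic_abs (x - y :: 'p::prime_card padic) \<le> B"
  using padic_abs_add_le[of x B "- y"] by simp

lemma padic_abs_sum_le:
  assumes "\<And>i. i \<in> A \<Longrightarrow> padic_abs (f i :: 'p::prime_card padic) \<le> B" "B \<ge> 0"
  shows "padic_abs (sum f A) \<le> B"
  using assms
  by (induction A rule: infinite_finite_induct) (auto intro!: padic_abs_add_le)

lemma padic_abs_sum_less:
  assumes "\<And>i. i \<in> A \<Longrightarrow> padic_abs (f i :: 'p::prime_card padic) < B" "B > 0"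
  shows "padic_abs (sum f A) < B"
  using assms
proof (induction A rule: infinite_finite_induct)
  case (insert x F)
  then have "max (padic_abs (f x)) (padic_abs (sum f F)) < B"
    by simp
  then show ?case
    using insert.hyps by (simp add: le_less_trans[OF padic_abs_ultra] del: max_less_iff_conj)
qed auto

text \<open>Apply the ultrametric inequality to \<open>x = (x + y) - y\<close>: the maximum on the
  right cannot be \<open>padic_abs y\<close>.\<close>

lemma padic_abs_add_eq:
  assumes "padic_abs y < padic_abs (x :: 'p::prime_card padic)"
  shows "padic_abs (x + y) = padic_abs x"
  using padic_abs_ultra[of x y] padic_abs_ultra[of "x + y" "- y"] assms
  by (simp add: max_def split: if_splits)

lemma padic_abs_mult_le_1:
  assumes "padic_abs (x :: 'p::prime_card padic) \<le> 1" "padic_abs y \<le> 1"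
  shows "padic_abs (x * y) \<le> 1"
  using assms mult_le_one[of "padic_abs x" "padic_abs y"] by (simp add: padic_abs_mult)

lemma padic_abs_of_int_multiplicity:
  "z \<noteq> 0 \<Longrightarrow> padic_abs (of_int z :: 'p::prime_card padic)
     = (1 / real CARD('p)) ^ multiplicity (int CARD('p)) z"
  using rat_pval_divide[OF prime_card[where 'a = 'p], of z 1]
  by (simp add: padic_abs_of_int_eq_rat rat_pabs_def power_int_minus power_one_over inverse_eq_divide)

lemma padic_abs_of_int_le_1: "padic_abs (of_int z :: 'p::prime_card padic) \<le> 1"
proof (cases "z = 0")
  case False
  then show ?thesis
    using CARD_gt_1[where 'p = 'p] by (simp add: padic_abs_of_int_multiplicity power_le_one)
qed simp

lemma padic_abs_of_nat_le_1: "padic_abs (of_nat n :: 'p::prime_card padic) \<le> 1"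
  using padic_abs_of_int_le_1[of "int n"] by simp

lemma padic_abs_of_int_le_power:
  assumes "int CARD('p) ^ n dvd z"
  shows "padic_abs (of_int z :: 'p::prime_card padic) \<le> (1 / real CARD('p)) ^ n"
proof (cases "z = 0")
  case False
  then have "n \<le> multiplicity (int CARD('p)) z"
    using assms prime_gt_1_nat[OF prime_card[where 'a = 'p]] by (intro multiplicity_geI) auto
  then show ?thesis
    using False CARD_gt_1[where 'p = 'p]
    by (simp add: padic_abs_of_int_multiplicity power_decreasing)
qed simp

lemma padic_abs_of_int_eq_1:
  assumes "\<not> int CARD('p) dvd z"
  shows "padic_abs (of_int z :: 'p::prime_card padic) = 1"
  using assms by (subst padic_abs_of_int_multiplicity) (auto simp: not_dvd_imp_multiplicity_0)

lemma padic_abs_of_nat_eq_1: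
  assumes "\<not> CARD('p) dvd n"
  shows "padic_abs (of_nat n :: 'p::prime_card padic) = 1"
  using padic_abs_of_int_eq_1[of "int n", where 'p = 'p] assms by simp

lemma padic_abs_CARD: "padic_abs (of_nat CARD('p) :: 'p::prime_card padic) = 1 / real CARD('p)"
proof -
  have "multiplicity (int CARD('p)) (int CARD('p)) = 1"
    using prime_gt_1_nat[OF prime_card[where 'a = 'p]] by (intro multiplicity_self) auto
  then show ?thesis
    using padic_abs_of_int_multiplicity[of "int CARD('p)", where 'p = 'p] by simp
qed

text \<open>Legendre's formula in recursive form: only the factors p, 2p, ..., qp of the factorial
  are non-units, and their product is p^q q!.\<close>

lemma padic_abs_fact_mult_CARD_add:
  "r < CARD('p) \<Longrightarrow> padic_abs (fact (CARD('p) * q + r) :: 'p::prime_card padic)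
     = (1 / real CARD('p)) ^ q * padic_abs (fact q :: 'p padic)"
proof (induction q arbitrary: r)
  case 0
  have "r < CARD('p) \<Longrightarrow> padic_abs (fact r :: 'p padic) = 1"
  proof (induction r)
    case (Suc r)
    have "\<not> CARD('p) dvd Suc r"
      using Suc.prems dvd_imp_le[of "CARD('p)" "Suc r"] by linarith
    then show ?case
      using Suc padic_abs_of_nat_eq_1[of "Suc r", where 'p = 'p]
      by (simp add: padic_abs_mult del: of_nat_Suc)
  qed simp
  with 0 show ?case by simp
next
  case (Suc q)
  let ?p = "CARD('p)"
  from \<open>r < ?p\<close> show ?case
  proof (induction r)
    case 0
    \<comment> \<open>The next multiple of p follows the largest remainder \<open>?p - 1\<close>, so
      the outer hypothesis is used at that remainder.\<close>
    have eq: "?p * Suc q = Suc (?p * q + (?p - 1))"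
      using prime_gt_0_nat[OF prime_card[where 'a = 'p]] by (simp add: algebra_simps)
    have "padic_abs (fact (?p * Suc q + 0) :: 'p padic)
        = padic_abs (of_nat (?p * Suc q) :: 'p padic) * padic_abs (fact (?p * q + (?p - 1)) :: 'p padic)"
      unfolding padic_abs_mult[symmetric] eq add_0_right fact_Suc ..
    also have "padic_abs (of_nat (?p * Suc q) :: 'p padic)
        = 1 / real ?p * padic_abs (of_nat (Suc q) :: 'p padic)"
      unfolding of_nat_mult padic_abs_mult padic_abs_CARD ..
    also have "padic_abs (fact (?p * q + (?p - 1)) :: 'p padic)
        = (1 / real ?p) ^ q * padic_abs (fact q :: 'p padic)"
      using prime_gt_0_nat[OF prime_card[where 'a = 'p]] by (intro Suc.IH) simp
    finally show ?case
      by (simp add: padic_abs_mult)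
  next
    case (Suc r)
    have "\<not> ?p dvd ?p * Suc q + Suc r"
      using Suc.prems dvd_add_right_iff[of ?p "?p * Suc q" "Suc r"] by (auto dest!: dvd_imp_le)
    then have "padic_abs (of_nat (?p * Suc q + Suc r) :: 'p padic) = 1"
      by (rule padic_abs_of_nat_eq_1)
    moreover have "padic_abs (fact (?p * Suc q + Suc r) :: 'p padic)
        = padic_abs (of_nat (?p * Suc q + Suc r) :: 'p padic) * padic_abs (fact (?p * Suc q + r) :: 'p padic)"
      unfolding padic_abs_mult[symmetric] add_Suc_right[of _ r] fact_Suc ..
    ultimately show ?case
      using Suc by simp
  qed
qed

text \<open>With q = n div p the recursion gives v(n!) = q + v(q!), which is at most 2q, hence at
  most pq and at most n.\<close>

lemma padic_abs_fact_ge: "padic_abs (fact n :: 'p::prime_card padic) \<ge> (1 / real CARD('p)) ^ n"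
proof (induction n rule: less_induct)
  case (less n)
  let ?p = "CARD('p)"
  define q where "q = n div ?p"
  have p: "?p \<ge> 2"
    using prime_ge_2_nat[OF prime_card[where 'a = 'p]] .
  show ?case
  proof (cases "n = 0")
    case False
    then have "q < n"
      using p by (simp add: q_def)
    have "2 * q \<le> ?p * q"
      using p by simp
    also have "\<dots> \<le> n"
      by (simp add: q_def)
    finally have "(1 / real ?p) ^ n \<le> (1 / real ?p) ^ (q + q)"
      using p by (intro power_decreasing) auto
    also have "\<dots> \<le> (1 / real ?p) ^ q * padic_abs (fact q :: 'p padic)"
      unfolding power_add using less[OF \<open>q < n\<close>] by (intro mult_left_mono) auto
    also have "\<dots> = padic_abs (fact (?p * q + n mod ?p) :: 'p padic)"
      using p by (subst padic_abs_fact_mult_CARD_add) auto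
    finally show ?thesis
      by (simp add: q_def)
  qed simp
qed

lemma padic_abs_fact_le_1: "padic_abs (fact n :: 'p::prime_card padic) \<le> 1"
  using padic_abs_of_nat_le_1[of "fact n", where 'p = 'p] by simp

section \<open>Topology\<close>

lemma tendsto_padic_iff:
  "(f \<longlongrightarrow> (l :: 'p::prime_card padic)) F \<longleftrightarrow> ((\<lambda>x. padic_abs (f x - l)) \<longlongrightarrow> 0) F"
  by (subst tendsto_dist_iff) (simp add: dist_padic_def)

lemma tendsto_padic_abs:
  assumes "(f \<longlongrightarrow> (l :: 'p::prime_card padic)) F"
  shows "((\<lambda>x. padic_abs (f x)) \<longlongrightarrow> padic_abs l) F"
  using tendsto_dist[OF assms tendsto_const[of 0]] by (simp add: dist_padic_def)

text \<open>Makes the general limit rules for sums and differences available; the next instance does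
  the same for products.\<close>

instance padic :: (prime_card) topological_ab_group_add
proof
  fix a b :: "'a padic"
  let ?F = "nhds a \<times>\<^sub>F nhds b"
  have fst: "(fst \<longlongrightarrow> a) ?F" and snd: "(snd \<longlongrightarrow> b) ?F"
    by (auto simp: filterlim_fst filterlim_snd)
  have "((\<lambda>x. padic_abs (fst x - a) + padic_abs (snd x - b)) \<longlongrightarrow> 0 + 0) ?F"
    using fst snd tendsto_padic_iff[of fst a ?F] tendsto_padic_iff[of snd b ?F]
    by (intro tendsto_add) auto
  then have lim: "((\<lambda>x. padic_abs (fst x - a) + padic_abs (snd x - b)) \<longlongrightarrow> 0) ?F"
    by simp
  have "padic_abs (fst x + snd x - (a + b)) \<le> padic_abs (fst x - a) + padic_abs (snd x - b)" for x
    using padic_abs_triangle[of "fst x - a" "snd x - b"] by (simp add: algebra_simps)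
  then show "((\<lambda>x. fst x + snd x) \<longlongrightarrow> a + b) ?F"
    unfolding tendsto_padic_iff[where f = "\<lambda>x. fst x + snd x"]
    by (intro Lim_null_comparison[OF _ lim]) (auto intro!: always_eventually)
  show "(uminus \<longlongrightarrow> - a) (nhds a)"
    using tendsto_padic_iff[of "\<lambda>x. x" a "nhds a"]
    unfolding tendsto_padic_iff[where f = uminus] by (simp add: filterlim_ident padic_abs_minus_commute)
qed

instance padic :: (prime_card) topological_monoid_mult
proof
  fix a b :: "'a padic"
  let ?F = "nhds a \<times>\<^sub>F nhds b"
  have fst: "(fst \<longlongrightarrow> a) ?F" and snd: "(snd \<longlongrightarrow> b) ?F"
    by (auto simp: filterlim_fst filterlim_snd)
  have "((\<lambda>x. padic_abs (fst x) * padic_abs (snd x - b) + padic_abs (fst x - a) * padic_abs b)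
      \<longlongrightarrow> padic_abs a * 0 + 0 * padic_abs b) ?F"
    using fst snd tendsto_padic_iff[of fst a ?F] tendsto_padic_iff[of snd b ?F]
    by (intro tendsto_intros tendsto_padic_abs) auto
  then have lim: "((\<lambda>x. padic_abs (fst x) * padic_abs (snd x - b) + padic_abs (fst x - a) * padic_abs b)
      \<longlongrightarrow> 0) ?F"
    by simp
  have "padic_abs (fst x * snd x - a * b)
      \<le> padic_abs (fst x) * padic_abs (snd x - b) + padic_abs (fst x - a) * padic_abs b" for x
    unfolding mult_diff_mult padic_abs_mult[symmetric] by (rule padic_abs_triangle)
  then show "((\<lambda>x. fst x * snd x) \<longlongrightarrow> a * b) ?F"
    unfolding tendsto_padic_iff[where f = "\<lambda>x. fst x * snd x"]
    by (intro Lim_null_comparison[OF _ lim]) (auto intro!: always_eventually)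
qed

lemma padic_abs_limit_le:
  assumes "X \<longlonglongrightarrow> (x :: 'p::prime_card padic)" "\<And>n. n \<ge> N \<Longrightarrow> padic_abs (X n) \<le> B"
  shows "padic_abs x \<le> B"
  using LIMSEQ_le_const2[OF tendsto_padic_abs[OF assms(1)]] assms(2) by blast

text \<open>By the ultrametric inequality a block of terms is no larger than its largest term, so
  the partial sums are Cauchy; completeness does the rest.\<close>

lemma padic_summable:
  fixes h :: "nat \<Rightarrow> 'p::prime_card padic"
  assumes "h \<longlonglongrightarrow> 0"
  shows "summable h"
proof -
  have "Cauchy (\<lambda>n. sum h {..<n})"
  proof (rule metric_CauchyI)
    fix e :: real assume e: "e > 0"
    obtain N where N: "\<And>n. n \<ge> N \<Longrightarrow> padic_abs (h n) < e"
      using metric_LIMSEQ_D[OF assms e] by (auto simp: dist_padic_def)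
    have *: "padic_abs (sum h {..<n} - sum h {..<m}) < e" if "m \<ge> N" "n \<ge> m" for m n
    proof -
      have "sum h {..<n} - sum h {..<m} = sum h {m..<n}"
        using sum_diff_nat_ivl[of 0 m n h] that by (simp add: atLeast0LessThan)
      then show ?thesis
        using that by (auto intro!: padic_abs_sum_less N e)
    qed
    show "\<exists>M. \<forall>m\<ge>M. \<forall>n\<ge>M. dist (sum h {..<m}) (sum h {..<n}) < e"
    proof (intro exI allI impI)
      fix m n assume "m \<ge> N" "n \<ge> N"
      then show "dist (sum h {..<m}) (sum h {..<n}) < e"
        using *[of m n] *[of n m] padic_abs_minus_commute[of "sum h {..<m}" "sum h {..<n}"]
        by (cases "m \<le> n") (auto simp: dist_padic_def)
    qed
  qed
  then show ?thesis
    by (simp add: Cauchy_convergent_iff summable_iff_convergent)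
qed

text \<open>With \<open>padic_cong_iff\<close> this translates the hypotheses from valuations to
  absolute values, in which the estimates are made.\<close>

lemma padic_integers_iff: "x \<in> padic_integers \<longleftrightarrow> padic_abs (x :: 'p::prime_card padic) \<le> 1"
proof (cases "x = 0")
  case False
  then show ?thesis
    using CARD_gt_1[where 'p = 'p]
    by (simp add: padic_integers_def padic_val_def zero_ereal_def log_le_zero_cancel_iff)
qed (simp add: padic_integers_def padic_val_def)

lemma padic_cong_iff:
  "padic_cong m x y \<longleftrightarrow> padic_abs (x - y :: 'p::prime_card padic) \<le> (1 / real CARD('p)) ^ m"
proof (cases "x = y")
  case False
  then have "padic_abs (x - y) > 0"
    by simp
  then have "real m \<le> - log (real CARD('p)) (padic_abs (x - y))
      \<longleftrightarrow> padic_abs (x - y) \<le> (1 / real CARD('p)) ^ m"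
    using CARD_gt_1[where 'p = 'p] log_le_iff[of "real CARD('p)" "padic_abs (x - y)" "- real m"]
    by (simp add: powr_minus powr_realpow power_one_over inverse_eq_divide) linarith
  then show ?thesis
    using False by (simp add: padic_cong_def padic_val_def)
qed (simp add: padic_cong_def padic_val_def)

text \<open>Choose a rational c/d within distance below 1 of x. It is then p-integral, so d is
  invertible modulo p^N, and the residue of c/d modulo p^N is the natural number sought.\<close>

lemma padic_nat_dense:
  assumes x: "padic_abs (x :: 'p::prime_card padic) \<le> 1" and e: "e > 0"
  shows "\<exists>n. padic_abs (x - of_nat n) < e"
proof -
  let ?p = "CARD('p)"
  obtain N where N: "(1 / real ?p) ^ N < e"
    using real_arch_pow_inv[OF e, of "1 / real ?p"] CARD_gt_1[where 'p = 'p] by auto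
  obtain q where q: "padic_abs (x - of_rat q) < min e 1"
    using padic_rat_dense[of "min e 1" x] e by (auto simp: dist_padic_def)
  obtain c d where cd: "quotient_of q = (c, d)"
    by (cases "quotient_of q") auto
  have d: "d > 0" "coprime c d" and qcd: "q = of_int c / of_int d"
    using quotient_of_denom_pos[OF cd] quotient_of_coprime[OF cd] quotient_of_div[OF cd] by auto
  have q1: "padic_abs (of_rat q :: 'p padic) \<le> 1"
    using padic_abs_diff_le[OF x, of "x - of_rat q"] q by simp
  have q_eq: "(of_rat q :: 'p padic) = of_int c / of_int d"
    by (simp add: qcd of_rat_divide)
  \<comment> \<open>If p divided d, coprimality would make c a unit, and c/d would have absolute
    value above 1.\<close>
  have pd: "\<not> int ?p dvd d"
  proof
    assume dvd: "int ?p dvd d"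
    have "int ?p > 1"
      using prime_gt_1_nat[OF prime_card[where 'a = 'p]] by simp
    then have "\<not> int ?p dvd c"
      using coprime_common_divisor[OF d(2) _ dvd] by (metis zdvd1_eq abs_of_nat less_irrefl)
    then have "padic_abs (of_int c :: 'p padic) = 1"
      by (rule padic_abs_of_int_eq_1)
    moreover have "padic_abs (of_int d :: 'p padic) \<le> 1 / real ?p"
      using padic_abs_of_int_le_power[of 1 d, where 'p = 'p] dvd by simp
    moreover have "padic_abs (of_int d :: 'p padic) > 0"
      using d by simp
    moreover have "1 / real ?p < 1"
      using CARD_gt_1[where 'p = 'p] by simp
    moreover have "padic_abs (of_int c :: 'p padic) \<le> padic_abs (of_int d :: 'p padic)"
      using q1 \<open>padic_abs (of_int d :: 'p padic) > 0\<close> by (simp add: q_eq padic_abs_divide)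
    ultimately show False
      by linarith
  qed
  have "coprime d (int ?p ^ N)"
    using pd prime_card_int[where 'a = 'p] prime_imp_coprime[of "int ?p" d]
    by (simp add: coprime_commute)
  then obtain e' where e': "[d * e' = 1] (mod int ?p ^ N)"
    using cong_solve_coprime_int by blast
  define n where "n = nat ((e' * c) mod (int ?p ^ N))"
  have "int n = (e' * c) mod (int ?p ^ N)"
    using prime_gt_0_nat[OF prime_card[where 'a = 'p]] by (simp add: n_def)
  then have "[int n = e' * c] (mod int ?p ^ N)"
    by (simp add: cong_def)
  then have "[d * int n = (d * e') * c] (mod int ?p ^ N)"
    by (simp add: cong_scalar_left mult.assoc)
  also have "[(d * e') * c = 1 * c] (mod int ?p ^ N)"
    using e' by (rule cong_scalar_right)
  finally have "int ?p ^ N dvd c - d * int n"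
    by (simp add: cong_iff_dvd_diff dvd_diff_commute)
  then have "padic_abs (of_int (c - d * int n) :: 'p padic) \<le> (1 / real ?p) ^ N"
    by (rule padic_abs_of_int_le_power)
  moreover have "of_rat q - of_nat n = of_int (c - d * int n) / (of_int d :: 'p padic)"
    using d by (simp add: q_eq field_simps)
  moreover have "padic_abs (of_int d :: 'p padic) = 1"
    using pd by (rule padic_abs_of_int_eq_1)
  ultimately have "padic_abs (of_rat q - of_nat n :: 'p padic) < e"
    using N by (simp add: padic_abs_divide)
  then have "padic_abs ((x - of_rat q) + (of_rat q - of_nat n)) < e"
    using q by (intro le_less_trans[OF padic_abs_ultra]) simp
  then show ?thesis
    by auto
qed

text \<open>Through such sequences, facts about natural exponents pass to p-adic integral ones by
  continuity.\<close>

lemma padic_nat_approx: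
  assumes "padic_abs (x :: 'p::prime_card padic) \<le> 1"
  obtains X :: "nat \<Rightarrow> nat" where "(\<lambda>n. of_nat (X n)) \<longlonglongrightarrow> x"
proof -
  have "\<forall>n. \<exists>m. padic_abs (x - of_nat m) < inverse (real (Suc n))"
    using padic_nat_dense[OF assms] by simp
  then obtain X where X: "\<And>n. padic_abs (x - of_nat (X n)) < inverse (real (Suc n))"
    by metis
  have "(\<lambda>n. of_nat (X n)) \<longlonglongrightarrow> x"
    unfolding tendsto_padic_iff
    by (rule tendsto_sandwich[OF _ _ tendsto_const LIMSEQ_inverse_real_of_nat])
       (use X in \<open>auto intro!: always_eventually less_imp_le simp: padic_abs_minus_commute[of _ x] simp del: of_nat_Suc\<close>)
  then show thesis
    by (rule that)
qed

section \<open>p-adic powers\<close>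

text \<open>At natural arguments these are ordinary binomial coefficients, hence integers; the bound
  survives in the limit.\<close>

lemma padic_abs_gbinomial_le_1:
  assumes "padic_abs (x :: 'p::prime_card padic) \<le> 1"
  shows "padic_abs (x gchoose j) \<le> 1"
proof -
  obtain X where X: "(\<lambda>n. of_nat (X n)) \<longlonglongrightarrow> x"
    using padic_nat_approx[OF assms] .
  have "(\<lambda>n. (\<Prod>i<j. of_nat (X n) - of_nat i) / fact j) \<longlonglongrightarrow> (\<Prod>i<j. x - of_nat i) / fact j"
    unfolding divide_inverse
    by (induction j) (auto intro!: tendsto_intros X simp: divide_inverse)
  then have "(\<lambda>n. of_nat (X n) gchoose j) \<longlonglongrightarrow> x gchoose j"
    by (simp add: gbinomial_prod_rev atLeast0LessThan)
  then show ?thesis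
    by (rule padic_abs_limit_le) (simp add: padic_abs_of_nat_le_1 flip: binomial_gbinomial)
qed

lemma continuous_on_padic_gbinomial:
  "continuous_on S (\<lambda>x :: 'p::prime_card padic. x gchoose j)"
proof -
  have "continuous_on S (\<lambda>x :: 'p padic. \<Prod>i<j. x - of_nat i)"
    by (induction j) (auto intro!: continuous_intros)
  then have "continuous_on S (\<lambda>x :: 'p padic. (\<Prod>i<j. x - of_nat i) * inverse (fact j))"
    by (intro continuous_intros)
  then show ?thesis
    by (simp add: gbinomial_prod_rev atLeast0LessThan divide_inverse)
qed

text \<open>The powers of p in \<open>padic_powr\<close> cancel and leave the binomial series, whose
  j-th term has size at most p^(-j).\<close>

lemma padic_powr_sums:
  fixes a x :: "'p::prime_card padic"
  assumes a: "padic_abs (a - 1) \<le> 1 / real CARD('p)" and x: "padic_abs x \<le> 1"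
  shows "(\<lambda>j. (a - 1) ^ j * (x gchoose j)) sums padic_powr a x"
proof -
  have p: "(of_nat CARD('p) :: 'p padic) \<noteq> 0"
    using prime_gt_0_nat[OF prime_card[where 'a = 'p]] by simp
  have eq: "((a - 1) / of_nat CARD('p)) ^ j * (\<Prod>i<j. x - of_nat i) * (of_nat CARD('p) ^ j / fact j)
      = (a - 1) ^ j * (x gchoose j)" for j
    using p by (simp add: gbinomial_prod_rev atLeast0LessThan power_divide)
  have "padic_abs ((a - 1) ^ j * (x gchoose j)) \<le> (1 / real CARD('p)) ^ j * 1" for j
    unfolding padic_abs_mult padic_abs_power
    by (intro mult_mono power_mono a padic_abs_gbinomial_le_1 x) auto
  moreover have lim: "(\<lambda>j. (1 / real CARD('p)) ^ j * 1) \<longlonglongrightarrow> 0"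
    using CARD_gt_1[where 'p = 'p] LIMSEQ_power_zero[of "1 / real CARD('p)"] by simp
  ultimately have "(\<lambda>j. (a - 1) ^ j * (x gchoose j)) \<longlonglongrightarrow> 0"
    unfolding tendsto_padic_iff by (intro Lim_null_comparison[OF _ lim] always_eventually) simp
  then have "summable (\<lambda>j. (a - 1) ^ j * (x gchoose j))"
    by (rule padic_summable)
  then show ?thesis
    unfolding padic_powr_def Let_def eq by (rule summable_sums)
qed

text \<open>The tail is bounded by its largest term. The bound is uniform in x, as the continuity
  proof requires.\<close>

lemma padic_powr_approx:
  fixes a x :: "'p::prime_card padic"
  assumes a: "padic_abs (a - 1) \<le> 1 / real CARD('p)" and x: "padic_abs x \<le> 1"
  shows "padic_abs (padic_powr a x - (\<Sum>j<N. (a - 1) ^ j * (x gchoose j))) \<le> (1 / real CARD('p)) ^ N"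
proof (rule padic_abs_limit_le)
  show "(\<lambda>M. (\<Sum>j<M. (a - 1) ^ j * (x gchoose j)) - (\<Sum>j<N. (a - 1) ^ j * (x gchoose j)))
      \<longlonglongrightarrow> padic_powr a x - (\<Sum>j<N. (a - 1) ^ j * (x gchoose j))"
    by (intro tendsto_diff tendsto_const padic_powr_sums[OF assms, unfolded sums_def])
  fix M assume "M \<ge> N"
  then have "(\<Sum>j<M. (a - 1) ^ j * (x gchoose j)) - (\<Sum>j<N. (a - 1) ^ j * (x gchoose j))
      = (\<Sum>j=N..<M. (a - 1) ^ j * (x gchoose j))"
    using sum_diff_nat_ivl[of 0 N M "\<lambda>j. (a - 1) ^ j * (x gchoose j)"] by (simp add: atLeast0LessThan)
  moreover have "padic_abs ((a - 1) ^ j * (x gchoose j)) \<le> (1 / real CARD('p)) ^ N" if "j \<ge> N" for j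
  proof -
    have "padic_abs ((a - 1) ^ j * (x gchoose j)) \<le> (1 / real CARD('p)) ^ j * 1"
      unfolding padic_abs_mult padic_abs_power
      by (intro mult_mono power_mono a padic_abs_gbinomial_le_1 x) auto
    also have "\<dots> \<le> (1 / real CARD('p)) ^ N"
      using that CARD_gt_1[where 'p = 'p] by (simp add: power_decreasing)
    finally show ?thesis .
  qed
  ultimately show "padic_abs ((\<Sum>j<M. (a - 1) ^ j * (x gchoose j)) - (\<Sum>j<N. (a - 1) ^ j * (x gchoose j)))
      \<le> (1 / real CARD('p)) ^ N"
    by (auto intro!: padic_abs_sum_le)
qed

lemma continuous_on_padic_powr:
  fixes a :: "'p::prime_card padic"
  assumes a: "padic_abs (a - 1) \<le> 1 / real CARD('p)"
  shows "continuous_on {x. padic_abs x \<le> 1} (padic_powr a)"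
proof (rule uniform_limit_theorem)
  show "\<forall>\<^sub>F N in sequentially. continuous_on {x :: 'p padic. padic_abs x \<le> 1}
      (\<lambda>x. \<Sum>j<N. (a - 1) ^ j * (x gchoose j))"
    by (intro always_eventually allI continuous_intros continuous_on_padic_gbinomial)
  show "uniform_limit {x :: 'p padic. padic_abs x \<le> 1}
      (\<lambda>N x. \<Sum>j<N. (a - 1) ^ j * (x gchoose j)) (padic_powr a) sequentially"
  proof (rule uniform_limitI)
    fix e :: real assume "e > 0"
    then obtain N where N: "(1 / real CARD('p)) ^ N < e"
      using real_arch_pow_inv[of e "1 / real CARD('p)"] CARD_gt_1[where 'p = 'p] by auto
    have "dist (\<Sum>j<M. (a - 1) ^ j * (x gchoose j)) (padic_powr a x) < e"
      if "M \<ge> N" "padic_abs x \<le> 1" for M x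
    proof -
      have "dist (\<Sum>j<M. (a - 1) ^ j * (x gchoose j)) (padic_powr a x) \<le> (1 / real CARD('p)) ^ M"
        using padic_powr_approx[OF a that(2), of M] by (simp add: dist_padic_def padic_abs_minus_commute)
      also have "\<dots> \<le> (1 / real CARD('p)) ^ N"
        using that CARD_gt_1[where 'p = 'p] by (intro power_decreasing) auto
      finally show ?thesis
        using N by simp
    qed
    then show "\<forall>\<^sub>F M in sequentially. \<forall>x\<in>{x :: 'p padic. padic_abs x \<le> 1}.
        dist (\<Sum>j<M. (a - 1) ^ j * (x gchoose j)) (padic_powr a x) < e"
      by (intro eventually_sequentiallyI[of N]) auto
  qed
qed simp

lemma tendsto_padic_powr:
  fixes a x :: "'p::prime_card padic"
  assumes "padic_abs (a - 1) \<le> 1 / real CARD('p)" and "X \<longlonglongrightarrow> x" "padic_abs x \<le> 1"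
    and "\<And>n. padic_abs (X n) \<le> 1"
  shows "(\<lambda>n. padic_powr a (X n)) \<longlonglongrightarrow> padic_powr a x"
  by (rule continuous_on_tendsto_compose[OF continuous_on_padic_powr[OF assms(1)] assms(2)])
     (use assms(3,4) in auto)

lemma padic_abs_eq_1_of_close:
  assumes "padic_abs (a - 1 :: 'p::prime_card padic) \<le> 1 / real CARD('p)"
  shows "padic_abs a = 1"
proof -
  have "1 / real CARD('p) < 1"
    using CARD_gt_1[where 'p = 'p] by simp
  with assms have "padic_abs (a - 1) < padic_abs (1 :: 'p padic)"
    by (simp only: padic_abs_1)
  from padic_abs_add_eq[OF this] show ?thesis
    by simp
qed

text \<open>Along natural exponents the absolute value is constantly 1. This keeps the coefficients
  \<open>c i * padic_powr (a i) x0\<close> nonzero later.\<close>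

lemma padic_abs_padic_powr:
  fixes a x :: "'p::prime_card padic"
  assumes a: "padic_abs (a - 1) \<le> 1 / real CARD('p)" and x: "padic_abs x \<le> 1"
  shows "padic_abs (padic_powr a x) = 1"
proof -
  obtain X where X: "(\<lambda>n. of_nat (X n)) \<longlonglongrightarrow> x"
    using padic_nat_approx[OF x] .
  then have "(\<lambda>n. padic_abs (padic_powr a (of_nat (X n)))) \<longlonglongrightarrow> padic_abs (padic_powr a x)"
    by (intro tendsto_padic_abs tendsto_padic_powr a x padic_abs_of_nat_le_1)
  then show ?thesis
    by (simp add: padic_powr_of_nat padic_abs_power padic_abs_eq_1_of_close[OF a] LIMSEQ_const_iff)
qed

lemma power_close_to_1:
  fixes a :: "'p::prime_card padic"
  assumes "padic_abs (a - 1) \<le> B" "B \<le> 1"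
  shows "padic_abs (a ^ n - 1) \<le> B"
proof (induction n)
  case 0
  then show ?case
    using order.trans[OF padic_abs_nonneg assms(1)] by simp
next
  case (Suc n)
  have a: "padic_abs a \<le> 1"
    using padic_abs_add_le[of "a - 1" 1 1] order.trans[OF assms] by simp
  have "padic_abs (a * (a ^ n - 1)) \<le> 1 * B"
    unfolding padic_abs_mult using Suc a by (intro mult_mono) auto
  then have "padic_abs (a * (a ^ n - 1) + (a - 1)) \<le> B"
    using assms(1) by (intro padic_abs_add_le) simp_all
  then show ?case
    by (simp add: algebra_simps)
qed

text \<open>For natural x and y this is the law of exponents; density and continuity extend it. It
  recentres \<open>f\<close> at \<open>x0\<close> and rescales the exponent.\<close>

lemma padic_powr_add_of_nat_mult:
  fixes a x y :: "'p::prime_card padic"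
  assumes a: "padic_abs (a - 1) \<le> 1 / real CARD('p)"
    and x: "padic_abs x \<le> 1" and y: "padic_abs y \<le> 1"
  shows "padic_powr a (x + of_nat m * y) = padic_powr a x * padic_powr (a ^ m) y"
proof -
  obtain X where X: "(\<lambda>n. of_nat (X n)) \<longlonglongrightarrow> x"
    using padic_nat_approx[OF x] .
  obtain Y where Y: "(\<lambda>n. of_nat (Y n)) \<longlonglongrightarrow> y"
    using padic_nat_approx[OF y] .
  have am: "padic_abs (a ^ m - 1) \<le> 1 / real CARD('p)"
    using CARD_gt_1[where 'p = 'p] by (intro power_close_to_1 a) simp
  have int: "padic_abs (u + of_nat m * v) \<le> 1" if "padic_abs u \<le> 1" "padic_abs v \<le> 1" for u v :: "'p padic"
    using that by (intro padic_abs_add_le padic_abs_mult_le_1 padic_abs_of_nat_le_1)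
  have "(\<lambda>n. padic_powr a (of_nat (X n) + of_nat m * of_nat (Y n))) \<longlonglongrightarrow> padic_powr a (x + of_nat m * y)"
    by (intro tendsto_padic_powr a int x y padic_abs_of_nat_le_1 tendsto_add tendsto_mult tendsto_const X Y)
  moreover have "padic_powr a (of_nat (X n) + of_nat m * of_nat (Y n))
      = padic_powr a (of_nat (X n)) * padic_powr (a ^ m) (of_nat (Y n))" for n
    using padic_powr_of_nat[of a "X n + m * Y n"]
    by (simp add: padic_powr_of_nat power_add power_mult)
  moreover have "(\<lambda>n. padic_powr a (of_nat (X n)) * padic_powr (a ^ m) (of_nat (Y n)))
      \<longlonglongrightarrow> padic_powr a x * padic_powr (a ^ m) y"
    by (intro tendsto_mult tendsto_padic_powr a am x y padic_abs_of_nat_le_1 X Y)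
  ultimately show ?thesis
    by (simp add: LIMSEQ_unique)
qed

section \<open>Roots of unity\<close>

text \<open>There are p summands, each congruent to 1 modulo p.\<close>

lemma padic_abs_power_sum_CARD_le:
  fixes a :: "'p::prime_card padic"
  assumes "padic_abs (a - 1) \<le> 1 / real CARD('p)"
  shows "padic_abs (\<Sum>i<CARD('p). a ^ i) \<le> 1 / real CARD('p)"
proof -
  have "padic_abs (\<Sum>i<CARD('p). a ^ i - 1) \<le> 1 / real CARD('p)"
    using CARD_gt_1[where 'p = 'p] by (intro padic_abs_sum_le power_close_to_1 assms) auto
  then have "padic_abs ((\<Sum>i<CARD('p). a ^ i - 1) + of_nat CARD('p)) \<le> 1 / real CARD('p)"
    by (intro padic_abs_add_le) (simp_all add: padic_abs_CARD)
  then show ?thesis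
    by (simp add: sum_subtractf)
qed

text \<open>Write b^p - 1 = (b - 1)(1 + b + ... + b^(p-1)): the second factor is divisible by p, so
  each p-th power gains a factor p.\<close>

lemma padic_abs_power_CARD_power_close_to_1:
  fixes a :: "'p::prime_card padic"
  assumes "padic_abs (a - 1) \<le> 1 / real CARD('p)"
  shows "padic_abs (a ^ CARD('p) ^ n - 1) \<le> (1 / real CARD('p)) ^ Suc n"
proof (induction n)
  case (Suc n)
  let ?b = "a ^ CARD('p) ^ n"
  have "padic_abs (?b - 1) \<le> 1 / real CARD('p)"
    using CARD_gt_1[where 'p = 'p] by (intro power_close_to_1 assms) auto
  then have "padic_abs (?b - 1) * padic_abs (\<Sum>i<CARD('p). ?b ^ i) \<le> (1 / real CARD('p)) ^ Suc n * (1 / real CARD('p))"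
    by (intro mult_mono Suc padic_abs_power_sum_CARD_le) auto
  moreover have "a ^ CARD('p) ^ Suc n - 1 = (?b - 1) * (\<Sum>i<CARD('p). ?b ^ i)"
    using power_diff_1_eq[of ?b "CARD('p)"] by (simp add: power_mult[symmetric] mult.commute)
  ultimately show ?case
    by (simp add: padic_abs_mult)
qed (use assms in simp)

text \<open>The error of the first-order binomial expansion. With \<open>B\<close> equal to 1/p it
  determines 1 + a + ... + a^(p-1) modulo p^2.\<close>

lemma power_linear_approx:
  fixes a :: "'p::prime_card padic"
  assumes "padic_abs (a - 1) \<le> B" "B \<le> 1"
  shows "padic_abs (a ^ n - 1 - of_nat n * (a - 1)) \<le> B\<^sup>2"
proof (induction n)
  case (Suc n)
  have "a ^ Suc n - 1 - of_nat (Suc n) * (a - 1)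
      = (a ^ n - 1) * (a - 1) + (a ^ n - 1 - of_nat n * (a - 1))" (is "?l = _")
    by (simp add: algebra_simps)
  moreover have "padic_abs ((a ^ n - 1) * (a - 1)) \<le> B\<^sup>2"
    unfolding padic_abs_mult power2_eq_square using assms order.trans[OF padic_abs_nonneg assms(1)]
    by (intro mult_mono power_close_to_1) auto
  ultimately have "padic_abs ?l \<le> B\<^sup>2"
    using Suc padic_abs_add_le by metis
  then show ?case .
qed simp

text \<open>For odd p the cofactor 1 + a + ... + a^(p-1) of a - 1 is congruent to p modulo p^2,
  hence nonzero: its linear part (a - 1) p (p - 1)/2 is divisible by p^2. For p = 2 the roots are 1
  and -1.\<close>

lemma root_of_unity_CARD:
  fixes a :: "'p::prime_card padic"
  assumes a: "padic_abs (a - 1) \<le> 1 / real CARD('p)" and 1: "a ^ CARD('p) = 1"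
    and m1: "CARD('p) = 2 \<Longrightarrow> a \<noteq> -1"
  shows "a = 1"
proof (cases "CARD('p) = 2")
  case True
  then show ?thesis
    using 1 m1 by (simp add: power2_eq_1_iff)
next
  case False
  let ?p = "CARD('p)"
  let ?B = "(1 / real ?p)\<^sup>2"
  have p: "real ?p > 1"
    by (rule CARD_gt_1)
  have "odd ?p"
    using False prime_odd_nat[OF prime_card[where 'a = 'p]] prime_ge_2_nat[OF prime_card[where 'a = 'p]]
    by simp
  then have "\<Sum>{..<?p} = ?p * ((?p - 1) div 2)"
    using Sum_Ico_nat[of 0 ?p] by (simp add: atLeast0LessThan div_mult_swap)
  then have "padic_abs ((\<Sum>i<?p. of_nat i * (a - 1)) :: 'p padic)
      = 1 / real ?p * (padic_abs (of_nat ((?p - 1) div 2) :: 'p padic) * padic_abs (a - 1))"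
    by (simp add: padic_abs_mult padic_abs_CARD flip: sum_distrib_right of_nat_sum)
  also have "\<dots> \<le> 1 / real ?p * (1 * (1 / real ?p))"
    by (intro mult_mono mult_left_mono a padic_abs_of_nat_le_1) auto
  finally have lin: "padic_abs ((\<Sum>i<?p. of_nat i * (a - 1)) :: 'p padic) \<le> ?B"
    by (simp add: power2_eq_square)
  have "padic_abs (\<Sum>i<?p. a ^ i - 1 - of_nat i * (a - 1)) \<le> ?B"
    using p by (intro padic_abs_sum_le power_linear_approx a) auto
  then have "padic_abs ((\<Sum>i<?p. a ^ i - 1 - of_nat i * (a - 1)) + (\<Sum>i<?p. of_nat i * (a - 1))) \<le> ?B"
    using lin by (rule padic_abs_add_le)
  also have "?B < padic_abs (of_nat ?p :: 'p padic)"
    using p by (simp add: padic_abs_CARD power2_eq_square field_simps)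
  finally have "padic_abs (of_nat ?p + ((\<Sum>i<?p. a ^ i - 1 - of_nat i * (a - 1)) + (\<Sum>i<?p. of_nat i * (a - 1))))
      = padic_abs (of_nat ?p :: 'p padic)"
    by (rule padic_abs_add_eq)
  then have "padic_abs (\<Sum>i<?p. a ^ i) = padic_abs (of_nat ?p :: 'p padic)"
    by (simp add: sum_subtractf)
  then have "(\<Sum>i<?p. a ^ i) \<noteq> 0"
    using p by (auto simp: padic_abs_CARD)
  moreover have "(a - 1) * (\<Sum>i<?p. a ^ i) = 0"
    using power_diff_1_eq[of a ?p] 1 by simp
  ultimately show ?thesis
    by simp
qed

lemma root_of_unity_CARD_power:
  fixes a :: "'p::prime_card padic"
  assumes a: "padic_abs (a - 1) \<le> 1 / real CARD('p)" and 1: "a ^ CARD('p) ^ n = 1"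
    and m1: "CARD('p) = 2 \<Longrightarrow> a \<noteq> -1"
  shows "a = 1"
  using 1
proof (induction n)
  case (Suc n)
  let ?b = "a ^ CARD('p) ^ n"
  have "?b = 1"
  proof (rule root_of_unity_CARD)
    show "padic_abs (?b - 1) \<le> 1 / real CARD('p)"
      using CARD_gt_1[where 'p = 'p] by (intro power_close_to_1 a) auto
    show "?b ^ CARD('p) = 1"
      using Suc.prems by (simp add: mult.commute flip: power_mult)
    \<comment> \<open>For n > 0 the power \<open>?b\<close> is congruent to 1 modulo 4, whereas -1
      is not; for n = 0 the hypothesis on \<open>a\<close> excludes -1.\<close>
    assume p: "CARD('p) = 2"
    show "?b \<noteq> -1"
    proof (cases "n = 0")
      case False
      then have "(1 / real CARD('p)) ^ Suc n \<le> (1 / real CARD('p)) ^ 2"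
        by (intro power_decreasing) auto
      moreover have "padic_abs (?b - 1) = 1 / 2" if "?b = -1"
        using padic_abs_CARD[where 'p = 'p] that by (simp add: p flip: minus_add_distrib)
      ultimately show ?thesis
        using padic_abs_power_CARD_power_close_to_1[OF a, of n] by (auto simp: p power2_eq_square)
    qed (use m1 p in simp)
  qed
  then show ?case
    by (rule Suc.IH)
qed simp

section \<open>Power sums\<close>

text \<open>A linear factor with integral root preserves integrality. This serves both the
  characteristic polynomial below and the falling factorials.\<close>

lemma integral_coeffs_linear_prod:
  fixes v :: "'i \<Rightarrow> 'p::prime_card padic"
  assumes "\<And>i. i \<in> I \<Longrightarrow> padic_abs (v i) \<le> 1"
  shows "padic_abs (coeff (\<Prod>i\<in>I. [:- v i, 1:]) n) \<le> 1"
  using assms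
proof (induction I arbitrary: n rule: infinite_finite_induct)
  case (insert i I)
  have "coeff ([:- v i, 1:] * q) n = (if n = 0 then 0 else coeff q (n - 1)) - v i * coeff q n" for q
    by (cases n) auto
  moreover have "padic_abs (v i) * padic_abs (coeff (\<Prod>i\<in>I. [:- v i, 1:]) n) \<le> 1"
    using insert by (intro mult_le_one) auto
  ultimately show ?case
    using insert by (auto intro!: padic_abs_diff_le simp: padic_abs_mult)
qed (auto simp: coeff_1)

text \<open>
  The power sums satisfy the linear recurrence with characteristic polynomial
  \<open>\<Prod>i. (X - v i)\<close>, whose coefficients are integral; hence the first
  \<open>card I\<close> of them dominate all others. They do not all vanish because
  \<open>P \<mapsto> \<Sum>i. d i * P (v i)\<close> is nonzero on a Lagrange polynomial.
\<close>

lemma power_sum_dominant_index: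
  fixes I :: "'i set" and d v :: "'i \<Rightarrow> 'p::prime_card padic"
  defines "z \<equiv> \<lambda>j. \<Sum>i\<in>I. d i * v i ^ j"
  assumes fin: "finite I" and ne: "I \<noteq> {}" and d: "\<And>i. i \<in> I \<Longrightarrow> d i \<noteq> 0"
    and inj: "inj_on v I" and v: "\<And>i. i \<in> I \<Longrightarrow> padic_abs (v i) \<le> 1"
  obtains j0 where "j0 < card I" "z j0 \<noteq> 0" "\<And>j. padic_abs (z j) \<le> padic_abs (z j0)"
proof -
  \<comment> \<open>The shift by \<open>r\<close> lets one polynomial yield the recurrence at every
    index.\<close>
  have functional: "(\<Sum>i\<in>I. d i * (v i ^ r * poly P (v i))) = (\<Sum>n\<le>degree P. coeff P n * z (n + r))" for P r
  proof -
    have "(\<Sum>i\<in>I. d i * (v i ^ r * poly P (v i)))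
        = (\<Sum>i\<in>I. \<Sum>n\<le>degree P. coeff P n * (d i * v i ^ (n + r)))"
      by (simp add: poly_altdef sum_distrib_left power_add ac_simps)
    also have "\<dots> = (\<Sum>n\<le>degree P. \<Sum>i\<in>I. coeff P n * (d i * v i ^ (n + r)))"
      by (rule sum.swap)
    finally show ?thesis
      by (simp add: z_def sum_distrib_left)
  qed
  have card: "card I > 0"
    using fin ne by (simp add: card_gt_0_iff)
  let ?abs = "\<lambda>j. padic_abs (z j)"
  have "Max (?abs ` {..<card I}) \<in> ?abs ` {..<card I}"
    using card by (intro Max_in) auto
  then obtain j0 where j0: "j0 < card I" "Max (?abs ` {..<card I}) = ?abs j0"
    by auto
  have small: "?abs j \<le> ?abs j0" if "j < card I" for j
    using that by (auto simp flip: j0(2) intro!: Max_ge)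
  have le: "?abs j \<le> ?abs j0" for j
  proof (induction j rule: less_induct)
    case (less j)
    show ?case
    proof (cases "j < card I")
      case False
      \<comment> \<open>\<open>Q\<close> is monic and vanishes at all \<open>v i\<close>, so
        \<open>z j\<close> is an integral combination of the \<open>card I\<close> preceding power
        sums.\<close>
      define Q where "Q = (\<Prod>i\<in>I. [:- v i, 1:])"
      have deg: "degree Q = card I"
        unfolding Q_def by (subst degree_prod_eq_sum_degree) auto
      have lead: "coeff Q (card I) = 1"
        using lead_coeff_prod[of "\<lambda>i. [:- v i, 1:]" I] deg by (simp add: Q_def)
      have "poly Q (v i) = 0" if "i \<in> I" for i
        using that fin by (auto simp: Q_def poly_prod)
      then have "(\<Sum>n\<le>card I. coeff Q n * z (n + (j - card I))) = 0"
        using functional[of "j - card I" Q] by (simp add: deg)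
      moreover have "{..card I} = insert (card I) {..<card I}"
        by auto
      ultimately have "z j = - (\<Sum>n<card I. coeff Q n * z (n + (j - card I)))"
        using False lead by (simp add: add_eq_0_iff2)
      moreover have "padic_abs (\<Sum>n<card I. coeff Q n * z (n + (j - card I))) \<le> ?abs j0"
      proof (rule padic_abs_sum_le)
        fix n assume "n \<in> {..<card I}"
        then have "?abs (n + (j - card I)) \<le> ?abs j0"
          using False by (intro less) auto
        then have "padic_abs (coeff Q n) * ?abs (n + (j - card I)) \<le> 1 * ?abs j0"
          unfolding Q_def by (intro mult_mono integral_coeffs_linear_prod v) auto
        then show "padic_abs (coeff Q n * z (n + (j - card I))) \<le> ?abs j0"
          by (simp add: padic_abs_mult)
      qed simp
      ultimately show ?thesis
        by simp
    qed (rule small)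
  qed
  have "z j0 \<noteq> 0"
  proof
    assume "z j0 = 0"
    with le have zero: "z j = 0" for j
      by (metis padic_abs_0 padic_abs_eq_0 padic_abs_nonneg order_antisym)
    obtain i0 where i0: "i0 \<in> I"
      using ne by blast
    \<comment> \<open>An unnormalised Lagrange polynomial: the only node where it does not vanish is
      \<open>v i0\<close>.\<close>
    define P where "P = (\<Prod>i\<in>I - {i0}. [:- v i, 1:])"
    have "poly P (v i) = 0" if "i \<in> I - {i0}" for i
      using that fin by (auto simp: P_def poly_prod)
    then have "(\<Sum>i\<in>I. d i * poly P (v i)) = d i0 * poly P (v i0)"
      using sum.remove[OF fin i0, of "\<lambda>i. d i * poly P (v i)"] by simp
    moreover have "(\<Sum>i\<in>I. d i * poly P (v i)) = 0"
      using functional[of 0 P] zero by simp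
    moreover have "v i0 \<noteq> v i" if "i \<in> I - {i0}" for i
      using inj i0 that unfolding inj_on_def by blast
    then have "poly P (v i0) \<noteq> 0"
      using fin by (auto simp: P_def poly_prod)
    ultimately show False
      using d[OF i0] by simp
  qed
  from that[OF j0(1) this le] show thesis .
qed

section \<open>Series of falling factorials\<close>

definition falling_poly :: "nat \<Rightarrow> 'p::prime_card padic poly" where
  "falling_poly j = (\<Prod>i<j. [:- of_nat i, 1:])"

lemma degree_falling_poly: "degree (falling_poly j :: 'p::prime_card padic poly) = j"
  unfolding falling_poly_def by (subst degree_prod_eq_sum_degree) auto

lemma coeff_falling_poly_self: "coeff (falling_poly j :: 'p::prime_card padic poly) j = 1"
proof -
  have "lead_coeff (falling_poly j :: 'p padic poly) = 1"
    unfolding falling_poly_def lead_coeff_prod by simp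
  then show ?thesis
    by (simp only: degree_falling_poly)
qed

lemma poly_falling_poly: "poly (falling_poly j) x = (\<Prod>i<j. x - of_nat i :: 'p::prime_card padic)"
  by (simp add: falling_poly_def poly_prod)

lemma coeff_falling_poly_le: "padic_abs (coeff (falling_poly j :: 'p::prime_card padic poly) n) \<le> 1"
  unfolding falling_poly_def by (rule integral_coeffs_linear_prod) (rule padic_abs_of_nat_le_1)

lemma padic_abs_poly_le:
  assumes "\<And>n. padic_abs (coeff P n) \<le> B" "padic_abs (x :: 'p::prime_card padic) \<le> 1"
  shows "padic_abs (poly P x) \<le> B"
proof -
  have "B \<ge> 0"
    using assms(1)[of 0] padic_abs_nonneg order.trans by blast
  moreover have "padic_abs (coeff P n) * padic_abs x ^ n \<le> B * 1" for n
    using assms \<open>B \<ge> 0\<close> by (intro mult_mono power_le_one) auto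
  ultimately show ?thesis
    unfolding poly_altdef by (intro padic_abs_sum_le) (auto simp: padic_abs_mult padic_abs_power)
qed

text \<open>Splitting off the constant term and a factor x lowers the order by one. The bound does
  not involve the degree, so it passes to limits of polynomials.\<close>

lemma padic_abs_poly_remainder:
  assumes "\<And>n. padic_abs (coeff P n) \<le> B" "padic_abs (x :: 'p::prime_card padic) \<le> 1"
  shows "padic_abs (poly P x - (\<Sum>n<l. coeff P n * x ^ n)) \<le> B * padic_abs x ^ l"
  using assms(1)
proof (induction l arbitrary: P)
  case 0
  then show ?case
    using padic_abs_poly_le[OF 0 assms(2)] by simp
next
  case (Suc l)
  obtain a Q where P: "P = pCons a Q"
    by (cases P)
  have "padic_abs (coeff Q n) \<le> B" for n
    using Suc.prems[of "Suc n"] by (simp add: P)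
  then have "padic_abs (poly Q x - (\<Sum>n<l. coeff Q n * x ^ n)) \<le> B * padic_abs x ^ l"
    by (rule Suc.IH)
  then have "padic_abs x * padic_abs (poly Q x - (\<Sum>n<l. coeff Q n * x ^ n)) \<le> padic_abs x * (B * padic_abs x ^ l)"
    by (intro mult_left_mono) auto
  moreover have "poly P x - (\<Sum>n<Suc l. coeff P n * x ^ n) = x * (poly Q x - (\<Sum>n<l. coeff Q n * x ^ n))"
    by (simp add: P sum.lessThan_Suc_shift sum_distrib_left algebra_simps del: sum.lessThan_Suc)
  ultimately show ?case
    by (simp add: padic_abs_mult mult_ac)
qed

text \<open>
  A Strassmann-type bound: the partial sums \<open>P N\<close> have coefficients converging to
  \<open>G n\<close>, and \<open>G J\<close> inherits the absolute value of the dominant \<open>h J\<close>. So the first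
  nonzero \<open>G l\<close> has \<open>l \<le> J\<close>, and the Taylor remainder is bounded uniformly in \<open>N\<close>.
\<close>

lemma falling_series_order_of_vanishing:
  fixes h :: "nat \<Rightarrow> 'p::prime_card padic"
  assumes h0: "h \<longlonglongrightarrow> 0" and hJ: "h J \<noteq> 0"
    and le: "\<And>j. padic_abs (h j) \<le> padic_abs (h J)"
    and less: "\<And>j. j > J \<Longrightarrow> padic_abs (h j) < padic_abs (h J)"
    and g: "\<And>s. padic_abs s \<le> 1 \<Longrightarrow> (\<lambda>N. \<Sum>j<N. h j * (\<Prod>i<j. s - of_nat i)) \<longlonglongrightarrow> g s"
    and g0: "g 0 = 0"
  obtains l and C :: "'p padic" and \<delta> where "0 < l" "l \<le> J" "C \<noteq> 0" "\<delta> > 0"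
    "\<And>s. padic_abs s \<le> 1 \<Longrightarrow> padic_abs s < \<delta> \<Longrightarrow> padic_abs (g s) = padic_abs C * padic_abs s ^ l"
proof -
  define H where "H = padic_abs (h J)"
  have H: "H > 0"
    using hJ by (simp add: H_def)
  define P where "P N = (\<Sum>j<N. smult (h j) (falling_poly j))" for N
  define G where "G n = (\<Sum>j. h j * coeff (falling_poly j) n)" for n
  have coeff_P: "coeff (P N) n = (\<Sum>j<N. h j * coeff (falling_poly j) n)" for N n
    by (simp add: P_def coeff_sum)
  have poly_P: "poly (P N) s = (\<Sum>j<N. h j * (\<Prod>i<j. s - of_nat i))" for N s
    by (simp add: P_def poly_sum poly_falling_poly)
  have term_le: "padic_abs (h j * coeff (falling_poly j) n) \<le> padic_abs (h j)" for j n
    using mult_left_mono[OF coeff_falling_poly_le padic_abs_nonneg] by (simp add: padic_abs_mult)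
  have "(\<lambda>j. h j * coeff (falling_poly j) n) \<longlonglongrightarrow> 0" for n
    unfolding tendsto_padic_iff
    by (rule Lim_null_comparison[OF _ tendsto_padic_abs[OF h0, simplified]])
       (auto intro!: always_eventually term_le)
  then have "summable (\<lambda>j. h j * coeff (falling_poly j) n)" for n
    by (rule padic_summable)
  then have lim_coeff: "(\<lambda>N. coeff (P N) n) \<longlonglongrightarrow> G n" for n
    unfolding coeff_P G_def by (rule summable_LIMSEQ)
  have coeff_le: "padic_abs (coeff (P N) n) \<le> H" for N n
    unfolding coeff_P H_def
    by (intro padic_abs_sum_le order.trans[OF term_le le]) auto
  \<comment> \<open>Terms with j < J have too small a degree, the term j = J contributes exactly
    \<open>h J\<close>, and all later ones are strictly smaller.\<close>
  have "padic_abs (coeff (P N) J) = H" if "N > J" for N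
  proof -
    have union: "{..<N} = {..<J} \<union> insert J {J<..<N}"
      using that by auto
    have "coeff (falling_poly j :: 'p padic poly) J = 0" if "j < J" for j
      using that by (intro coeff_eq_0) (simp add: degree_falling_poly)
    then have "coeff (P N) J = h J + (\<Sum>j\<in>{J<..<N}. h j * coeff (falling_poly j) J)"
      unfolding coeff_P union by (subst sum.union_disjoint) (auto simp: coeff_falling_poly_self)
    moreover have "padic_abs (\<Sum>j\<in>{J<..<N}. h j * coeff (falling_poly j) J) < padic_abs (h J)"
      using H by (intro padic_abs_sum_less le_less_trans[OF term_le less]) (auto simp: H_def)
    ultimately show ?thesis
      by (simp add: padic_abs_add_eq H_def)
  qed
  then have "(\<lambda>N. padic_abs (coeff (P N) J)) \<longlonglongrightarrow> H"
    by (intro tendsto_eventually eventually_sequentiallyI[of "Suc J"]) simp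
  with tendsto_padic_abs[OF lim_coeff] have "padic_abs (G J) = H"
    by (rule LIMSEQ_unique)
  with H have GJ: "G J \<noteq> 0"
    by auto
  have taylor: "padic_abs (g s - (\<Sum>n<m. G n * s ^ n)) \<le> H * padic_abs s ^ m" if "padic_abs s \<le> 1" for s m
  proof (rule padic_abs_limit_le)
    show "(\<lambda>N. poly (P N) s - (\<Sum>n<m. coeff (P N) n * s ^ n)) \<longlonglongrightarrow> g s - (\<Sum>n<m. G n * s ^ n)"
      unfolding poly_P by (intro tendsto_diff tendsto_sum tendsto_mult g that lim_coeff tendsto_const)
  qed (intro padic_abs_poly_remainder coeff_le that)
  define l where "l = (LEAST n. G n \<noteq> 0)"
  have l: "G l \<noteq> 0" "l \<le> J" "\<And>n. n < l \<Longrightarrow> G n = 0"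
    unfolding l_def
    using LeastI[of "\<lambda>n. G n \<noteq> 0", OF GJ] Least_le[of "\<lambda>n. G n \<noteq> 0", OF GJ]
    by (auto dest: not_less_Least)
  \<comment> \<open>The remainder bound of order 1 at s = 0 forces \<open>G 0 = g 0\<close>.\<close>
  have "G 0 = 0"
    using taylor[of 0 1] padic_abs_pos_iff[of "G 0"] by (simp add: g0 not_less del: padic_abs_pos_iff)
  with l(1) have "l \<noteq> 0"
    by metis
  \<comment> \<open>Below the radius \<open>padic_abs (G l) / H\<close> the remainder bound of order
    \<open>Suc l\<close> is smaller than the leading term \<open>G l * s ^ l\<close>.\<close>
  show thesis
  proof (rule that[of l "G l" "padic_abs (G l) / H"])
    show "0 < l" "l \<le> J" "G l \<noteq> 0" "padic_abs (G l) / H > 0"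
      using \<open>l \<noteq> 0\<close> l H by auto
    fix s :: "'p padic" assume s: "padic_abs s \<le> 1" "padic_abs s < padic_abs (G l) / H"
    show "padic_abs (g s) = padic_abs (G l) * padic_abs s ^ l"
    proof (cases "s = 0")
      case False
      have "padic_abs (g s - G l * s ^ l) \<le> H * padic_abs s ^ Suc l"
        using taylor[OF s(1), of "Suc l"] l(3) by simp
      also have "\<dots> < padic_abs (G l) * padic_abs s ^ l"
        using s(2) H False by (simp add: field_simps)
      finally have "padic_abs (G l * s ^ l + (g s - G l * s ^ l)) = padic_abs (G l * s ^ l)"
        by (intro padic_abs_add_eq) (simp add: padic_abs_mult padic_abs_power)
      then show ?thesis
        by (simp add: padic_abs_mult padic_abs_power)
    qed (use \<open>l \<noteq> 0\<close> g0 in auto)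
  qed
qed

section \<open>Zeros of exponential sums\<close>

text \<open>Take logarithms. At x = 0 both sides are infinite, because l > 0 and the valuation of
  \<open>D\<close> is finite.\<close>

lemma padic_val_of_abs_eq:
  fixes x y D :: "'p::prime_card padic"
  assumes eq: "padic_abs y = padic_abs D * padic_abs x ^ l" and D: "D \<noteq> 0" and l: "l > 0"
  shows "padic_val y = padic_val D + ereal (real l) * padic_val x"
proof (cases "x = 0")
  case True
  then have "padic_abs y = 0"
    using eq l by simp
  then show ?thesis
    using True D l by (simp add: padic_val_def)
next
  case False
  then have "padic_abs x > 0" "padic_abs D > 0"
    using D by simp_all
  moreover from this have "y \<noteq> 0"
    using eq by (auto simp del: padic_abs_pos_iff)
  ultimately show ?thesis
    using False D by (simp add: padic_val_def eq log_mult log_nat_power del: padic_abs_pos_iff)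
qed

text \<open>Selects a Strassmann index: in the induction a new value takes over as soon as it is at
  least the current maximum.\<close>

lemma last_maximal_index:
  fixes w :: "nat \<Rightarrow> real"
  assumes "k > 0"
  obtains J where "J < k" "\<And>j. j < k \<Longrightarrow> w j \<le> w J" "\<And>j. J < j \<Longrightarrow> j < k \<Longrightarrow> w j < w J"
proof -
  have "\<exists>J<k. (\<forall>j<k. w j \<le> w J) \<and> (\<forall>j. J < j \<longrightarrow> j < k \<longrightarrow> w j < w J)"
    using assms
  proof (induction k rule: nat_induct_non_zero)
    case (Suc k)
    then obtain J where J: "J < k" "\<forall>j<k. w j \<le> w J" "\<forall>j. J < j \<longrightarrow> j < k \<longrightarrow> w j < w J"
      by blast
    show ?case
    proof (cases "w k < w J")
      case True
      then show ?thesis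
        using J by (intro exI[of _ J]) (auto simp: less_Suc_eq)
    next
      case False
      then show ?thesis
        using J by (intro exI[of _ k]) (force simp: less_Suc_eq)
    qed
  qed auto
  then show thesis
    using that by blast
qed

theorem theorem3:
  fixes k :: nat
    and a c :: "nat \<Rightarrow> 'p::prime_card padic"
    and f :: "'p padic \<Rightarrow> 'p padic"
    and x0 :: "'p padic"
  assumes "k \<ge> 2"
    and "\<forall>i\<in>{1..k}. a i \<in> padic_integers"
    and "inj_on a {1..k}"
    and "\<forall>i\<in>{1..k}. padic_cong 1 (a i) 1"
    and "CARD('p) = 2 \<longrightarrow> (\<forall>i\<in>{1..k}. \<forall>j\<in>{1..k}. a j / a i \<noteq> -1)"
    and "\<forall>i\<in>{1..k}. c i \<noteq> 0"
    and "\<forall>x\<in>padic_integers. f x = (\<Sum>i=1..k. c i * padic_powr (a i) x)"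
    and "x0 \<in> padic_integers"
    and "f x0 = 0"
  shows "(\<exists>(\<alpha>::int) (l::nat) (m::nat). 0 < l \<and> l < k \<and>
           (\<forall>t\<in>padic_integers. padic_cong m t x0 \<longrightarrow>
              padic_val (f t) = ereal (real_of_int \<alpha>) + ereal (real l) * padic_val (t - x0)))
       \<and> x0 isolated_in {x \<in> padic_integers. f x = 0}"
proof -
  note k = \<open>k \<ge> 2\<close>
  let ?p = "CARD('p)"
  define r where "r = 1 / real ?p"
  have r: "0 < r" "r < 1"
    using CARD_gt_1[where 'p = 'p] by (simp_all add: r_def)
  \<comment> \<open>Exponents are rescaled by \<open>\<pi> = p ^ M\<close> with \<open>M > k\<close>: this decay beats \<open>1 / j!\<close>, so every
    \<open>h j\<close> with \<open>j \<ge> k\<close> is smaller than \<open>h j0\<close>.\<close>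
  define M where "M = Suc k"
  define \<pi> :: "'p padic" where "\<pi> = of_nat (?p ^ M)"
  have abs_\<pi>: "padic_abs \<pi> = r ^ M"
    by (simp add: \<pi>_def padic_abs_power padic_abs_CARD r_def)
  have \<pi>: "\<pi> \<noteq> 0"
    using abs_\<pi> r(1) by auto
  have x0: "padic_abs x0 \<le> 1"
    using assms(8) by (simp add: padic_integers_iff)
  have close: "padic_abs (a i - 1) \<le> 1 / real ?p" if "i \<in> {1..k}" for i
    using assms(4) that by (auto simp: padic_cong_iff)
  have abs_a: "padic_abs (a i) = 1" if "i \<in> {1..k}" for i
    using close[OF that] by (rule padic_abs_eq_1_of_close)

  \<comment> \<open>Rescaled bases and coefficients\<close>
  define d where "d i = c i * padic_powr (a i) x0" for i
  define A where "A i = a i ^ ?p ^ M" for i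
  define v where "v i = (A i - 1) / \<pi>" for i
  have A: "A i - 1 = \<pi> * v i" for i
    using \<pi> by (simp add: v_def)
  have d_nz: "d i \<noteq> 0" if "i \<in> {1..k}" for i
  proof -
    have "padic_abs (padic_powr (a i) x0) = 1"
      using close[OF that] x0 by (rule padic_abs_padic_powr)
    then show ?thesis
      using assms(6) that by (auto simp: d_def)
  qed
  have abs_v: "padic_abs (v i) \<le> 1" if "i \<in> {1..k}" for i
  proof -
    \<comment> \<open>The factors p gained by the iterated p-th powers pay for the division by
      \<open>\<pi>\<close>.\<close>
    have "padic_abs (A i - 1) \<le> r ^ Suc M"
      unfolding A_def r_def by (rule padic_abs_power_CARD_power_close_to_1[OF close[OF that]])
    also have "\<dots> \<le> r ^ M"
      using r by (intro power_decreasing) auto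
    finally show ?thesis
      using r(1) by (simp add: v_def padic_abs_divide abs_\<pi>)
  qed
  have "inj_on v {1..k}"
  proof (rule inj_onI)
    fix i j assume ij: "i \<in> {1..k}" "j \<in> {1..k}" "v i = v j"
    have nz: "a j \<noteq> 0"
      using abs_a[OF ij(2)] by auto
    have "A i = A j"
      using ij(3) A by (metis diff_add_cancel)
    then have root: "(a i / a j) ^ ?p ^ M = 1"
      using nz by (simp add: A_def power_divide)
    have ratio_close: "padic_abs (a i / a j - 1) \<le> 1 / real ?p"
    proof -
      have "a i / a j - 1 = ((a i - 1) - (a j - 1)) / a j"
        using nz by (simp add: field_simps)
      then show ?thesis
        using padic_abs_diff_le[OF close[OF ij(1)] close[OF ij(2)]] abs_a[OF ij(2)]
        by (simp add: padic_abs_divide)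
    qed
    have "a i / a j = 1"
      using assms(5) ij(1,2) by (intro root_of_unity_CARD_power[OF ratio_close root]) blast
    then have "a i = a j"
      using nz by simp
    then show "i = j"
      by (rule inj_onD[OF assms(3) _ ij(1,2)])
  qed
  then obtain j0 where j0: "j0 < card {1..k}" "(\<Sum>i\<in>{1..k}. d i * v i ^ j0) \<noteq> 0"
      "\<And>j. padic_abs (\<Sum>i\<in>{1..k}. d i * v i ^ j) \<le> padic_abs (\<Sum>i\<in>{1..k}. d i * v i ^ j0)"
    using k power_sum_dominant_index[of "{1..k}" d v, OF _ _ d_nz _ abs_v] by auto

  \<comment> \<open>The rescaled function as a series of falling factorials\<close>
  define z where "z j = (\<Sum>i=1..k. d i * v i ^ j)" for j
  define h where "h j = \<pi> ^ j * z j / fact j" for j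
  define g where "g s = (\<Sum>i=1..k. d i * padic_powr (A i) s)" for s
  define Z where "Z = padic_abs (z j0)"
  have Z: "Z > 0" "\<And>j. padic_abs (z j) \<le> Z"
    using j0 by (simp_all add: Z_def z_def)
  have f_eq: "f (x0 + \<pi> * s) = g s" if s: "padic_abs s \<le> 1" for s
  proof -
    have "padic_abs (x0 + \<pi> * s) \<le> 1"
      unfolding \<pi>_def by (intro padic_abs_add_le x0 padic_abs_mult_le_1 padic_abs_of_nat_le_1 s)
    then have "f (x0 + \<pi> * s) = (\<Sum>i=1..k. c i * padic_powr (a i) (x0 + \<pi> * s))"
      using assms(7) by (simp add: padic_integers_iff)
    also have "\<dots> = g s"
      unfolding g_def \<pi>_def d_def A_def
      by (intro sum.cong refl) (simp only: padic_powr_add_of_nat_mult[OF close x0 s] mult.assoc)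
    finally show ?thesis .
  qed
  have g_lim: "(\<lambda>N. \<Sum>j<N. h j * (\<Prod>i<j. s - of_nat i)) \<longlonglongrightarrow> g s" if s: "padic_abs s \<le> 1" for s
  proof -
    have close_A: "padic_abs (A i - 1) \<le> 1 / real ?p" if "i \<in> {1..k}" for i
      unfolding A_def using r by (intro power_close_to_1 close that) (simp add: r_def)
    \<comment> \<open>The factorial in \<open>h j\<close> turns the falling factorial into a
      binomial coefficient, and \<open>\<pi> ^ j * v i ^ j\<close> is
      \<open>(A i - 1) ^ j\<close>.\<close>
    have "h j * (\<Prod>i<j. s - of_nat i) = (\<Sum>i=1..k. d i * ((A i - 1) ^ j * (s gchoose j)))" for j
      by (simp add: h_def z_def A gbinomial_prod_rev atLeast0LessThan power_mult_distrib
          sum_distrib_left sum_distrib_right sum_divide_distrib mult_ac)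
    then have "(\<Sum>j<N. h j * (\<Prod>i<j. s - of_nat i))
        = (\<Sum>i=1..k. d i * (\<Sum>j<N. (A i - 1) ^ j * (s gchoose j)))" for N
      by (simp add: sum.swap[of _ "{..<N}"] sum_distrib_left)
    moreover have "(\<lambda>N. \<Sum>i=1..k. d i * (\<Sum>j<N. (A i - 1) ^ j * (s gchoose j))) \<longlonglongrightarrow> g s"
      unfolding g_def
      by (intro tendsto_sum tendsto_mult tendsto_const
          padic_powr_sums[OF close_A s, unfolded sums_def])
    ultimately show ?thesis
      by simp
  qed

  \<comment> \<open>Sizes of the coefficients and the dominant index\<close>
  have abs_h: "padic_abs (h j) = r ^ (M * j) * padic_abs (z j) / padic_abs (fact j :: 'p padic)" for j
    by (simp add: h_def padic_abs_mult padic_abs_divide padic_abs_power abs_\<pi> power_mult)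
  \<comment> \<open>Since \<open>M = k + 1\<close>, one factor \<open>r ^ j\<close> can be spent on
    the division by \<open>fact j\<close>.\<close>
  have h_le: "padic_abs (h j) \<le> r ^ (k * j) * Z" for j
  proof -
    have "r ^ (M * j) * padic_abs (z j) \<le> (r ^ (k * j) * r ^ j) * Z"
      using r(1) Z by (intro mult_mono) (auto simp: M_def power_add add.commute)
    also have "\<dots> \<le> r ^ (k * j) * Z * padic_abs (fact j :: 'p padic)"
      using padic_abs_fact_ge[of j, where 'p = 'p] r(1) Z(1)
      by (simp add: r_def mult_ac mult_left_mono)
    finally show ?thesis
      by (simp add: abs_h pos_divide_le_eq)
  qed
  have "h \<longlonglongrightarrow> 0"
  proof -
    have "padic_abs (h j) \<le> r ^ j * Z" for j
      using k r Z(1)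
      by (intro order.trans[OF h_le] mult_right_mono power_decreasing) auto
    moreover have lim: "(\<lambda>j. r ^ j * Z) \<longlonglongrightarrow> 0"
      using r tendsto_mult_right[OF LIMSEQ_power_zero[of r], of Z] by simp
    ultimately show ?thesis
      unfolding tendsto_padic_iff by (intro Lim_null_comparison[OF _ lim] always_eventually) simp
  qed
  have h_less: "padic_abs (h j) < padic_abs (h j0)" if "j \<ge> k" for j
  proof -
    obtain k' where k': "k = Suc k'"
      using k by (cases k) auto
    \<comment> \<open>The margin is exactly one: (k + 1)(k - 1) = k^2 - 1 < k^2.\<close>
    have "M * j0 \<le> M * k'"
      using j0(1) by (simp add: k')
    also have "\<dots> < k * k"
      by (simp add: M_def k')
    also have "\<dots> \<le> k * j"
      using that by simp
    finally have "r ^ (k * j) < r ^ (M * j0)"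
      using r by (intro power_strict_decreasing) auto
    then have "padic_abs (h j) < r ^ (M * j0) * Z"
      using h_le[of j] Z(1) by (meson le_less_trans mult_strict_right_mono)
    also have "\<dots> \<le> padic_abs (h j0)"
      using padic_abs_fact_le_1[of j0, where 'p = 'p] r(1) Z(1)
      by (simp add: abs_h Z_def pos_le_divide_eq mult_left_le)
    finally show ?thesis .
  qed
  \<comment> \<open>From index k on every \<open>h j\<close> is smaller than \<open>h j0\<close>, so
    the last maximum below k is the last maximum overall.\<close>
  obtain J where J: "J < k" "\<And>j. j < k \<Longrightarrow> padic_abs (h j) \<le> padic_abs (h J)"
      "\<And>j. J < j \<Longrightarrow> j < k \<Longrightarrow> padic_abs (h j) < padic_abs (h J)"
    using last_maximal_index[of k "\<lambda>j. padic_abs (h j)"] k by auto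
  have h_less_J: "padic_abs (h j) < padic_abs (h J)" if "j \<ge> k" for j
    using h_less[OF that] J(2)[of j0] j0(1) by simp
  have "padic_abs (h J) > 0"
    using le_less_trans[OF padic_abs_nonneg h_less_J[OF order.refl]] .
  then have hJ: "h J \<noteq> 0"
    by simp
  have h_le_J: "padic_abs (h j) \<le> padic_abs (h J)" for j
    using J(2)[of j] h_less_J[of j] by (cases "j < k") auto
  have h_less_J: "padic_abs (h j) < padic_abs (h J)" if "j > J" for j
    using that J(3)[of j] h_less_J[of j] by (cases "j < k") auto
  have "g 0 = 0"
    using f_eq[of 0] assms(9) by simp
  then obtain l and C :: "'p padic" and \<delta>
    where l: "0 < l" "l \<le> J" and C: "C \<noteq> 0" and \<delta>: "\<delta> > 0"
      and g: "\<And>s. padic_abs s \<le> 1 \<Longrightarrow> padic_abs s < \<delta> \<Longrightarrow> padic_abs (g s) = padic_abs C * padic_abs s ^ l"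
    using falling_series_order_of_vanishing[OF \<open>h \<longlonglongrightarrow> 0\<close> hJ h_le_J h_less_J g_lim] by metis

  \<comment> \<open>Return to the original variable\<close>
  obtain N where N: "r ^ N < \<delta>"
    using real_arch_pow_inv[OF \<delta> r(2)] by auto
  \<comment> \<open>\<open>M\<close> compensates the division of \<open>t - x0\<close> by
    \<open>\<pi>\<close>, and \<open>N\<close> brings the quotient below
    \<open>\<delta>\<close>.\<close>
  define m where "m = M + N"
  define D where "D = C / \<pi> ^ l"
  have D: "D \<noteq> 0"
    using C \<pi> by (simp add: D_def)
  have f_abs: "padic_abs (f t) = padic_abs D * padic_abs (t - x0) ^ l" if t: "padic_abs (t - x0) \<le> r ^ m" for t
  proof -
    define s where "s = (t - x0) / \<pi>"
    have "padic_abs s \<le> r ^ N"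
      using t r(1) by (simp add: s_def padic_abs_divide abs_\<pi> m_def power_add field_simps)
    moreover have "r ^ N \<le> 1"
      using r by (simp add: power_le_one)
    ultimately have s: "padic_abs s \<le> 1" "padic_abs s < \<delta>"
      using N by auto
    have "t = x0 + \<pi> * s"
      using \<pi> by (simp add: s_def)
    then have "padic_abs (f t) = padic_abs C * padic_abs s ^ l"
      using f_eq[OF s(1)] g[OF s] by simp
    then show ?thesis
      by (simp add: s_def D_def padic_abs_divide padic_abs_power power_divide)
  qed
  obtain \<alpha> :: int where \<alpha>: "padic_val D = ereal (real_of_int \<alpha>)"
    using padic_val_eq_of_int[OF D] by blast
  have "padic_val (f t) = ereal (real_of_int \<alpha>) + ereal (real l) * padic_val (t - x0)"
    if "padic_cong m t x0" for t
    using padic_val_of_abs_eq[OF f_abs D l(1)] that by (simp add: \<alpha> padic_cong_iff r_def)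
  moreover have "x0 isolated_in {x \<in> padic_integers. f x = 0}"
    unfolding isolated_in_dist_Ex_iff
  \<comment> \<open>On the ball of radius \<open>r ^ m\<close> the formula \<open>f_abs\<close>
    applies, and its right side vanishes only at \<open>x0\<close>.\<close>
  proof (intro conjI exI[of _ "r ^ m"] ballI impI)
    fix y assume y: "y \<in> {x \<in> padic_integers. f x = 0}" "dist x0 y < r ^ m"
    then have "padic_abs D * padic_abs (y - x0) ^ l = 0"
      using f_abs[of y] by (simp add: dist_padic_def padic_abs_minus_commute)
    then show "y = x0"
      using D by simp
  qed (use assms(8,9) r in auto)
  ultimately show ?thesis
    using l J(1) le_less_trans by blast
qed

end
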